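(* For every integer $n \geq 2$, $$P_n(x) = \sum_{T \in \mathcal{T}_{n-1}^o} 2^{\mathrm{fr}(T)-\mathrm{g}(T)}\, x^{\mathrm{v}(T)}(1+x)^{\mathrm{g}(T)}.$$
   Context: The polynomials $P_n(x)$ are defined by $P_1(x)=1$ and $P_{n+1}(x) = \frac{(x+2)(x+1)}{2}P_n(x+2) - \frac{x(x-1)}{2}P_n(x)$ for $n\ge 1$. For integers $a\le b$, $[a,b]=\{a,\dots,b\}$ and $[m]=[1,m]$. Fix $m\ge1$. Consider a grid with $m$ columns numbered $1,\dots,m$ from left to right and $2m+1$ rows numbered from bottom to top; $(j:i)$ denotes the box in column $j$ and row $i$ (and a point in it). $\mathcal{T}_m^o$ is the set of placements of points in this grid such that every column contains exactly two points, every row contains at most one point, each of the rows $1,\dots,m$ contains exactly one point, and every point $(j:i)$ satisfies $i\ge j$. Thus exactly one row of $T\in\mathcal{T}_m^o$ is empty (the empty row). For a nonempty row $i$, $p_i^T$ is its unique point. In a column, the point with larger row index is the upper point, the other the lower point. A point $(j:i)$ is free if $i\ge 2m+2-j$; $\mathrm{fr}(T)$ is the number of free points. Paths. For a point $p_0$ of $T$ define $p_0,p_1,\dots$, writing $p_k=(j_k:i_k)$: if $j_k=m$ then $p_{k+1}=p_k$; if $j_k<m$ and $p_k$ is the upper point of its column, $p_{k+1}=p^T_{2m+1-j_k}$; if $j_k<m$ and $p_k$ is the lower point, $p_{k+1}=p^T_{j_k}$; but if the row designated by one of the last two rules is the empty row, then $p_k=p_{k_0}$ for all $k>k_0$, where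 $p_{k_0}$ is the current point. For a row $i$: if $i$ is the empty row, $S_T(i)$ is the empty sequence; otherwise $S_T(i)$ is the subsequence $(p_{k_0},\dots,p_{k_f})$ of the sequence starting at $p_0=p_i^T$ given by $k_0=0$ and, as long as $j_{k_q}<\max_{k\ge0}j_k$, $k_{q+1}=\min\{k>k_q:j_k>j_{k_q}\}$, stopping at the first $q=f$ with $j_{k_q}=\max_k j_k$. Let $V(T)=S_T(2m+1)$ and let $\mathrm{v}(T)$ be its number of elements. Roots. For a point $(j:i)$ of $T$, let $i_0=i$ and for $k\ge0$: if $i_k\in[j,2m+1-j]\cup\{2m+1\}$ then $i_{k+1}=i_k$; if $i_k\in[2m+2-j,2m]$ then $i_{k+1}$ is the row of the upper point of column $2m+1-i_k$; if $i_k\in[1,j-1]$ then $i_{k+1}$ is the row of the lower point of column $i_k$. This sequence is eventually constant, with eventual value $\mathrm{root}_T(j:i)$. $\mathcal{G}(T)$ is the set of free points $p=(j:i)$ of $T$ such that the other point of column $j$ belongs to $V(T)$ and $\mathrm{root}_T(j:i)=j$; $\mathrm{g}(T)=|\mathcal{G}(T)|$. *)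

theory Defs
  imports "HOL-Computational_Algebra.Polynomial"
begin

(* The recursion starts at index 1; the value at 0 is a dummy. *)
fun Pn :: "nat \<Rightarrow> rat poly" where
  "Pn 0 = 0"
| "Pn (Suc 0) = 1"
| "Pn (Suc (Suc n)) =
     smult (1/2) ([:2, 1:] * [:1, 1:] * pcompose (Pn (Suc n)) [:2, 1:])
     - smult (1/2) ([:0, 1:] * [:-1, 1:] * Pn (Suc n))"

(* The box (j:i) in column j and row i is the pair (j, i). *)
type_synonym point = "nat \<times> nat"

definition placements :: "nat \<Rightarrow> point set set" where
  "placements m = {T. T \<subseteq> {1..m} \<times> {1..2*m+1}
     \<and> (\<forall>j\<in>{1..m}. card {i. (j, i) \<in> T} = 2)
     \<and> (\<forall>i\<in>{1..2*m+1}. card {j. (j, i) \<in> T} \<le> 1)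
     \<and> (\<forall>i\<in>{1..m}. card {j. (j, i) \<in> T} = 1)
     \<and> (\<forall>(j, i)\<in>T. j \<le> i)}"

definition row_empty :: "point set \<Rightarrow> nat \<Rightarrow> bool" where
  "row_empty T i \<longleftrightarrow> (\<forall>j. (j, i) \<notin> T)"

definition row_point :: "point set \<Rightarrow> nat \<Rightarrow> point" where
  "row_point T i = (THE p. p \<in> T \<and> snd p = i)"

definition upper_row :: "point set \<Rightarrow> nat \<Rightarrow> nat" where
  "upper_row T j = Max {i. (j, i) \<in> T}"

definition lower_row :: "point set \<Rightarrow> nat \<Rightarrow> nat" where
  "lower_row T j = Min {i. (j, i) \<in> T}"

(* Below, all points lie in columns 1..m, so the truncated subtractions
   2*m+1-j and 2*m+2-j are exact. Since G_set m T is a subset of free_points m T,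
   the exponent fr_stat m T - g_stat m T is exact too. *)

definition free_points :: "nat \<Rightarrow> point set \<Rightarrow> point set" where
  "free_points m T = {(j, i) \<in> T. i \<ge> 2*m+2-j}"

definition fr_stat :: "nat \<Rightarrow> point set \<Rightarrow> nat" where
  "fr_stat m T = card (free_points m T)"

definition path_target :: "nat \<Rightarrow> point set \<Rightarrow> point \<Rightarrow> nat" where
  "path_target m T = (\<lambda>(j, i). if i = upper_row T j then 2*m+1-j else j)"

definition path_step :: "nat \<Rightarrow> point set \<Rightarrow> point \<Rightarrow> point" where
  "path_step m T p =
     (if fst p = m \<or> row_empty T (path_target m T p) then p
      else row_point T (path_target m T p))"

definition point_path :: "nat \<Rightarrow> point set \<Rightarrow> point \<Rightarrow> nat \<Rightarrow> point" where
  "point_path m T p k = (path_step m T ^^ k) p"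

definition path_col :: "nat \<Rightarrow> point set \<Rightarrow> point \<Rightarrow> nat \<Rightarrow> nat" where
  "path_col m T p k = fst (point_path m T p k)"

(* record_index m T p q is the index k_q of the q-th left-to-right maximum of the
   column sequence; it is only used up to the last such maximum. *)
fun record_index :: "nat \<Rightarrow> point set \<Rightarrow> point \<Rightarrow> nat \<Rightarrow> nat" where
  "record_index m T p 0 = 0"
| "record_index m T p (Suc q) =
     (LEAST k. k > record_index m T p q
        \<and> path_col m T p k > path_col m T p (record_index m T p q))"

definition last_record :: "nat \<Rightarrow> point set \<Rightarrow> point \<Rightarrow> nat" where
  "last_record m T p =
     (LEAST q. path_col m T p (record_index m T p q) = Max (range (path_col m T p)))"

definition S_seq :: "nat \<Rightarrow> point set \<Rightarrow> nat \<Rightarrow> point list" where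
  "S_seq m T i =
     (if row_empty T i then []
      else let p = row_point T i in
        map (\<lambda>q. point_path m T p (record_index m T p q)) [0..<Suc (last_record m T p)])"

definition V_seq :: "nat \<Rightarrow> point set \<Rightarrow> point list" where
  "V_seq m T = S_seq m T (2*m+1)"

definition v_stat :: "nat \<Rightarrow> point set \<Rightarrow> nat" where
  "v_stat m T = length (V_seq m T)"

(* The column j of the starting point stays fixed while the row i moves. *)
definition root_step :: "nat \<Rightarrow> point set \<Rightarrow> nat \<Rightarrow> nat \<Rightarrow> nat" where
  "root_step m T j i =
     (if i \<in> {j..2*m+1-j} \<union> {2*m+1} then i
      else if i \<in> {2*m+2-j..2*m} then upper_row T (2*m+1-i)
      else lower_row T i)"

definition root_row :: "nat \<Rightarrow> point set \<Rightarrow> point \<Rightarrow> nat" where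
  "root_row m T = (\<lambda>(j, i). THE r. \<exists>N. \<forall>k\<ge>N. (root_step m T j ^^ k) i = r)"

definition G_set :: "nat \<Rightarrow> point set \<Rightarrow> point set" where
  "G_set m T = {(j, i) \<in> free_points m T.
     (\<exists>i'. i' \<noteq> i \<and> (j, i') \<in> T \<and> (j, i') \<in> set (V_seq m T))
     \<and> root_row m T (j, i) = j}"

definition g_stat :: "nat \<Rightarrow> point set \<Rightarrow> nat" where
  "g_stat m T = card (G_set m T)"

end

theory Submission
  imports Defs "HOL-Combinatorics.Transposition"
begin

text \<open>
  With \<open>C = x(x - 1)/2\<close> the recursion reads
  \<open>P\<^sub>n\<^sub>+\<^sub>1 = (C P\<^sub>n)(x + 2) - (C P\<^sub>n)(x)\<close>. Hence, for a set \<open>X\<close>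
  of size \<open>x\<close>, the value \<open>P\<^sub>m\<^sub>+\<^sub>1(x)\<close> counts the sequences of two-element sets
  \<open>A\<^sub>j \<subseteq> X \<union> [j, 2m + 1 - j]\<close>, \<open>1 \<le> j \<le> m\<close>, such that each pair \<open>{j, 2m + 1 - j}\<close> meets some \<open>A\<^sub>i\<close>
  with \<open>i \<le> j\<close>.

  A placement is built column by column. For column \<open>j\<close> the root map is a bijection from the
  rows not yet used onto the slots \<open>[j, 2m + 1 - j] \<union> {2m + 1}\<close>, so that the column amounts to a
  two-element set of slots. The slot \<open>2m + 1\<close> plays the role of \<open>X\<close>: the points of \<open>V(T)\<close> are those
  with root \<open>2m + 1\<close>, and a point is free iff its root is \<open>2m + 1\<close> or an already used row. The
  condition on the rows \<open>1, \<dots>, m\<close> says that slot \<open>j\<close> is a used row or picked by column \<open>j\<close>.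

  Both counts are thus sums over sequences of two-element sets. Their transition weights differ,
  but they agree after averaging over the involutions exchanging the slots \<open>i\<close> and \<open>2m + 1 - i\<close>:
  the averaged weight of a state with set \<open>D\<close> of used slots is \<open>2\<^bsup>|D|\<^esup>\<close> times the count of the
  first kind.
\<close>

subsection \<open>Two-element subsets\<close>

definition pairs :: "'a set \<Rightarrow> 'a set set" where
  "pairs Y = {A. A \<subseteq> Y \<and> card A = 2}"

lemma finite_pairs [simp]: "finite Y \<Longrightarrow> finite (pairs Y)"
  by (simp add: pairs_def)

lemma pairs_empty [simp]: "pairs {} = {}"
  by (auto simp: pairs_def)

lemma sum_pairs_insert:
  assumes "finite Y" "a \<notin> Y"
  shows "sum f (pairs (insert a Y)) = sum f (pairs Y) + (\<Sum>t\<in>Y. f {a, t})"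
proof -
  have *: "pairs (insert a Y) = pairs Y \<union> (\<lambda>t. {a, t}) ` Y"
  proof (intro equalityI subsetI)
    fix A assume A: "A \<in> pairs (insert a Y)"
    show "A \<in> pairs Y \<union> (\<lambda>t. {a, t}) ` Y"
    proof (cases "a \<in> A")
      case True
      have "card (A - {a}) = 1"
        using A True by (simp add: pairs_def)
      then obtain t where "A - {a} = {t}"
        by (auto simp: card_1_singleton_iff)
      then have "A = {a, t}" "t \<in> Y"
        using A True by (auto simp: pairs_def)
      then show ?thesis by auto
    qed (use A in \<open>auto simp: pairs_def\<close>)
  qed (use assms in \<open>auto simp: pairs_def card_insert_if\<close>)
  have "sum f (pairs (insert a Y)) = sum f (pairs Y) + sum f ((\<lambda>t. {a, t}) ` Y)"
    unfolding * using assms by (intro sum.union_disjoint) (auto simp: pairs_def)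
  also have "sum f ((\<lambda>t. {a, t}) ` Y) = (\<Sum>t\<in>Y. f {a, t})"
    using assms by (subst sum.reindex) (auto simp: inj_on_def doubleton_eq_iff)
  finally show ?thesis .
qed

text \<open>Each unordered pair arises from two ordered ones, and on the diagonal
  \<open>s = t\<close> the double insertion collapses to a single one.\<close>

lemma sum_sum_eq_sum_pairs:
  fixes f :: "'a set \<Rightarrow> 'b :: comm_semiring_1"
  assumes "finite Y"
  shows "(\<Sum>s\<in>Y. \<Sum>t\<in>Y. f (insert s (insert t D)))
    = 2 * (\<Sum>A\<in>pairs Y. f (D \<union> A)) + (\<Sum>s\<in>Y. f (insert s D))"
  using assms
proof (induction Y)
  case (insert a Y)
  have "(\<Sum>s\<in>Y. f (insert s (insert a D))) = (\<Sum>t\<in>Y. f (insert a (insert t D)))"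
    by (simp add: insert_commute)
  moreover have "f (D \<union> {a, t}) = f (insert a (insert t D))" for t
    by (metis Un_commute Un_insert_left sup_bot.left_neutral)
  ultimately show ?case
    using insert by (simp add: sum_pairs_insert sum.distrib algebra_simps mult_2)
qed simp

subsection \<open>The polynomial recursion as a count\<close>

definition px :: "rat poly" where "px = [:0, 1:]"

definition binom2 :: "rat poly" where
  "binom2 = smult (1/2) ([:0, 1:] * [:-1, 1:])"

definition shift2 :: "rat poly \<Rightarrow> rat poly" where
  "shift2 f = pcompose f [:2, 1:]"

lemma shift2_simps:
  "shift2 (f + g) = shift2 f + shift2 g" "shift2 (f - g) = shift2 f - shift2 g"
  "shift2 (f * g) = shift2 f * shift2 g" "shift2 (smult c f) = smult c (shift2 f)"
  "shift2 1 = 1" "shift2 px = px + 2" "shift2 binom2 = binom2 + 2 * px + 1"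
  by (simp_all add: shift2_def pcompose_add pcompose_diff pcompose_mult pcompose_smult
      pcompose_pCons numeral_poly one_pCons px_def binom2_def)

lemma two_binom2: "2 * binom2 = px * (px - 1)"
  by (simp add: px_def binom2_def numeral_poly one_pCons)

definition shift_op :: "bool \<Rightarrow> rat poly \<Rightarrow> rat poly" where
  "shift_op b f = (if b then shift2 f else shift2 f - f)"

lemma shift_op_simps:
  "shift_op b (f + g) = shift_op b f + shift_op b g"
  "shift_op b (smult c f) = smult c (shift_op b f)"
  by (simp_all add: shift_op_def shift2_simps smult_diff_right)

text \<open>\<open>slots m M\<close> is the interval \<open>[j, 2m + 1 - j]\<close> of the innermost \<open>M = m + 1 - j\<close> pairs.\<close>

definition slots :: "nat \<Rightarrow> nat \<Rightarrow> nat set" where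
  "slots m M = {m + 1 - M..m + M}"

text \<open>The two slots are \<open>j\<close> and \<open>2m + 1 - j\<close> for
  \<open>j = m - M\<close>, the pair by which \<open>slots m (Suc M)\<close> exceeds
  \<open>slots m M\<close>.\<close>

definition hit :: "nat \<Rightarrow> nat \<Rightarrow> nat set \<Rightarrow> bool" where
  "hit m M D \<longleftrightarrow> m - M \<in> D \<or> m + 1 + M \<in> D"

text \<open>A pair that is already hit contributes a plain shift, since the subtracted term of the
  recursion only serves to exclude the sequences missing the pair.\<close>

fun shift_iter :: "nat \<Rightarrow> nat \<Rightarrow> nat set \<Rightarrow> rat poly \<Rightarrow> rat poly" where
  "shift_iter m 0 D q = q"
| "shift_iter m (Suc M) D q = shift_iter m M D (shift_op (hit m M D) (binom2 * q))"

lemma slots_0 [simp]: "slots m 0 = {}"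
  by (simp add: slots_def)

lemma slots_Suc: "M < m \<Longrightarrow> slots m (Suc M) = insert (m - M) (insert (m + 1 + M) (slots m M))"
  by (auto simp: slots_def)

lemma finite_slots [simp]: "finite (slots m M)"
  by (simp add: slots_def)

lemma slots_notin [simp]:
  "M < m \<Longrightarrow> m - M \<notin> slots m M" "m + 1 + M \<notin> slots m M" "Suc (m + M) \<notin> slots m M"
  "M \<le> m \<Longrightarrow> Suc (2 * m) \<notin> slots m M"
  by (auto simp: slots_def)

lemma Pn_Suc_Suc: "Pn (Suc (Suc n)) = shift_op False (binom2 * Pn (Suc n))"
proof -
  have *: "smult (1/2) ([:2, 1:] * [:1, 1:] * f) = shift2 binom2 * f"
    "smult (1/2) ([:0, 1:] * [:-1, 1:] * f) = binom2 * f" for f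
    by (simp_all only: mult_smult_left [symmetric])
      (simp_all add: binom2_def shift2_def pcompose_mult pcompose_smult pcompose_pCons)
  show ?thesis
    by (simp only: Pn.simps * shift_op_def shift2_simps(3) if_False) (simp only: shift2_def)
qed

text \<open>With no slot used every pair is unhit, so each step is one step of the recursion for
  \<open>Pn\<close>.\<close>

lemma shift_iter_empty_Pn: "shift_iter m M {} (Pn (Suc n)) = Pn (Suc (M + n))"
proof (induction M arbitrary: n)
  case (Suc M)
  have "shift_iter m (Suc M) {} (Pn (Suc n)) = shift_iter m M {} (Pn (Suc (Suc n)))"
    by (simp add: Pn_Suc_Suc hit_def del: Pn.simps)
  then show ?case using Suc[of "Suc n"] by (simp del: Pn.simps)
qed simp

lemma shift_iter_add: "shift_iter m M D (q + r) = shift_iter m M D q + shift_iter m M D r"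
  by (induction M arbitrary: q r) (simp_all add: shift_op_simps distrib_left)

lemma shift_iter_smult: "shift_iter m M D (smult c q) = smult c (shift_iter m M D q)"
  by (induction M arbitrary: q) (simp_all add: shift_op_simps)

lemma shift_iter_cong:
  assumes "D \<inter> slots m M = D' \<inter> slots m M" "M \<le> m"
  shows "shift_iter m M D q = shift_iter m M D' q"
  using assms
proof (induction M arbitrary: q)
  case (Suc M)
  have "hit m M D = hit m M D'" "D \<inter> slots m M = D' \<inter> slots m M"
    using Suc.prems by (auto simp: slots_Suc hit_def set_eq_iff)
  then show ?case using Suc by simp
qed simp

lemma shift_op_mult_px: "shift_op b (px * f) = px * shift_op b f + smult 2 (shift2 f)"
proof -
  have "2 * shift2 f = smult 2 (shift2 f)"
    by (simp add: numeral_poly)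
  then show ?thesis
    by (simp add: shift_op_def shift2_simps(3,6) algebra_simps)
qed

text \<open>The Leibniz rule behind the recursion: the factor \<^term>\<open>px\<close> counts the ways of
  picking an element of a set which each shift enlarges by two slots.\<close>

lemma shift_iter_mult_px:
  assumes "M \<le> m"
  shows "shift_iter m M D (px * q) = px * shift_iter m M D q
      + (\<Sum>t\<in>slots m M. shift_iter m M (insert t D) q)"
  using assms
proof (induction M arbitrary: q)
  case (Suc M)
  let ?h = "hit m M D"
  have "shift_iter m (Suc M) D (px * q) = shift_iter m M D (shift_op ?h (px * (binom2 * q)))"
    by (simp only: shift_iter.simps ac_simps)
  also have "\<dots> = shift_iter m M D (px * shift_op ?h (binom2 * q))
      + smult 2 (shift_iter m M D (shift2 (binom2 * q)))"
    by (simp only: shift_op_mult_px shift_iter_add shift_iter_smult)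
  also have "\<dots> = px * shift_iter m (Suc M) D q + (\<Sum>t\<in>slots m M. shift_iter m (Suc M) (insert t D) q)
      + smult 2 (shift_iter m M D (shift2 (binom2 * q)))"
  proof -
    have "shift_iter m (Suc M) (insert t D) q
        = shift_iter m M (insert t D) (shift_op ?h (binom2 * q))"
      if "t \<in> slots m M" for t
    proof -
      have "t \<noteq> m - M" "t \<noteq> m + 1 + M"
        using that Suc.prems by (auto simp: slots_def)
      then show ?thesis by (auto simp: hit_def)
    qed
    then show ?thesis using Suc by simp
  qed
  \<comment> \<open>Inserting either slot of the outermost pair makes that pair hit and affects no
    inner one, so both insertions give the plain shift.\<close>
  also have "smult 2 (shift_iter m M D (shift2 (binom2 * q)))
      = shift_iter m (Suc M) (insert (m - M) D) q + shift_iter m (Suc M) (insert (m + 1 + M) D) q"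
  proof -
    have "shift_iter m (Suc M) (insert t D) q = shift_iter m M D (shift2 (binom2 * q))"
      if "t = m - M \<or> t = m + 1 + M" for t
    proof -
      have "hit m M (insert t D)" using that by (auto simp: hit_def)
      moreover have "shift_iter m M (insert t D) r = shift_iter m M D r" for r
        using that Suc.prems by (intro shift_iter_cong) auto
      ultimately show ?thesis by (simp add: shift_op_def)
    qed
    moreover have "smult 2 p = p + p" for p :: "rat poly"
      by (metis smult_add_left one_add_one smult_1_left)
    ultimately show ?thesis by simp
  qed
  finally show ?case
    using Suc.prems by (simp add: slots_Suc del: shift_iter.simps)
qed simp

text \<open>Counting by how many elements of the first two-element set lie in
  \<open>slots m M\<close>: none, one or two. The others come from the \<open>x + 2\<close> elements
  of \<open>X\<close> and the outermost pair, without restriction. Algebraically,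
  \<open>shift2 binom2\<close> is expanded in powers of \<open>px\<close> and
  \<open>shift_iter_mult_px\<close> is applied to each power.\<close>

lemma shift_iter_hit:
  assumes "M < m" "hit m M D"
  shows "2 * shift_iter m (Suc M) D 1 = (px + 1) * (px + 2) * shift_iter m M D 1
    + 2 * (px + 2) * (\<Sum>t\<in>slots m M. shift_iter m M (insert t D) 1)
    + 2 * (\<Sum>A\<in>pairs (slots m M). shift_iter m M (D \<union> A) 1)"
proof -
  let ?Q0 = "shift_iter m M D 1" and ?Q1 = "\<Sum>t\<in>slots m M. shift_iter m M (insert t D) 1"
    and ?Q2 = "\<Sum>A\<in>pairs (slots m M). shift_iter m M (D \<union> A) 1"
  have x: "shift_iter m M E px = px * shift_iter m M E 1
      + (\<Sum>t\<in>slots m M. shift_iter m M (insert t E) 1)" for E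
    using shift_iter_mult_px[of M m E 1] assms by simp
  have xx: "shift_iter m M D (px * px) = px * (px * ?Q0 + ?Q1)
      + (px * ?Q1 + (2 * ?Q2 + ?Q1))"
  proof -
    have "shift_iter m M D (px * px)
        = px * shift_iter m M D px + (\<Sum>t\<in>slots m M. shift_iter m M (insert t D) px)"
      using shift_iter_mult_px[of M m D px] assms by simp
    also have "(\<Sum>t\<in>slots m M. shift_iter m M (insert t D) px) = px * ?Q1
        + (\<Sum>t\<in>slots m M. \<Sum>s\<in>slots m M. shift_iter m M (insert s (insert t D)) 1)"
      by (simp only: x sum.distrib sum_distrib_left)
    also have "(\<Sum>t\<in>slots m M. \<Sum>s\<in>slots m M. shift_iter m M (insert s (insert t D)) 1)
        = 2 * ?Q2 + ?Q1"
      using sum_sum_eq_sum_pairs[of "slots m M" "\<lambda>E. shift_iter m M E 1" D]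
      by (subst sum.swap) simp
    finally show ?thesis by (simp only: x)
  qed
  have "2 * shift2 binom2 = px * px + smult 3 px + smult 2 1"
  proof -
    have "2 * shift2 binom2 = px * px + 3 * px + 2"
      unfolding shift2_simps using two_binom2 by algebra
    then show ?thesis by (simp add: numeral_poly)
  qed
  moreover have "2 * shift_iter m (Suc M) D 1 = shift_iter m M D (2 * shift2 binom2)"
    using assms shift_iter_smult[of m M D 2] by (simp add: shift_op_def numeral_poly)
  ultimately have "2 * shift_iter m (Suc M) D 1
      = shift_iter m M D (px * px) + smult 3 (shift_iter m M D px) + smult 2 ?Q0"
    by (simp only: shift_iter_add shift_iter_smult)
  then have "2 * shift_iter m (Suc M) D 1
      = shift_iter m M D (px * px) + 3 * shift_iter m M D px + 2 * ?Q0"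
    by (simp add: numeral_poly)
  then show ?thesis
    by (simp only: xx x) (simp add: algebra_simps)
qed

text \<open>Now the first set has to meet the outermost pair: it is the pair itself, or one of its
  two slots together with an element of \<open>X\<close> or of \<open>slots m M\<close>.\<close>

lemma shift_iter_not_hit:
  assumes "M < m" "\<not> hit m M D"
  shows "shift_iter m (Suc M) D 1 = (2 * px + 1) * shift_iter m M D 1
      + 2 * (\<Sum>t\<in>slots m M. shift_iter m M (insert t D) 1)"
proof -
  have "shift_op False binom2 = smult 2 px + 1"
    by (simp add: shift_op_def shift2_simps numeral_poly)
  then have "shift_iter m (Suc M) D 1 = smult 2 (shift_iter m M D px) + shift_iter m M D 1"
    using assms by (simp add: shift_iter_add shift_iter_smult)
  also have "shift_iter m M D px = px * shift_iter m M D 1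
      + (\<Sum>t\<in>slots m M. shift_iter m M (insert t D) 1)"
    using shift_iter_mult_px[of M m D 1] assms by simp
  finally show ?thesis
    by (simp add: numeral_poly algebra_simps smult_add_right)
qed

subsection \<open>Averaging over exchanges of slots\<close>

definition swap :: "nat \<Rightarrow> nat \<Rightarrow> nat \<Rightarrow> nat" where
  "swap m M = transpose (m - M) (m + 1 + M)"

text \<open>The sum over all \<open>2 ^ M\<close> products of the swaps of the innermost
  \<open>M\<close> pairs, that is, the average without its denominator.\<close>

fun swap_sum :: "nat \<Rightarrow> nat \<Rightarrow> (nat set \<Rightarrow> rat poly) \<Rightarrow> nat set \<Rightarrow> rat poly" where
  "swap_sum m 0 f D = f D"
| "swap_sum m (Suc M) f D = swap_sum m M f D + swap_sum m M f (swap m M ` D)"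

text \<open>The weight of a point of column \<open>a\<close> with root \<open>s\<close>, where
  \<open>D\<close> holds the used rows and \<open>A\<close> the roots of both points of the column.
  Root \<open>2m + 1\<close> means free and in \<open>V(T)\<close>; a root in \<open>D\<close> means
  free; root \<open>a\<close> in \<open>D\<close> beside a point with root \<open>2m + 1\<close>
  means membership in \<open>G_set\<close>.\<close>

definition pick_wt :: "nat \<Rightarrow> nat \<Rightarrow> nat set \<Rightarrow> nat set \<Rightarrow> nat \<Rightarrow> rat poly" where
  "pick_wt m a D A s =
     (if s = 2 * m + 1 then 2 * px
      else if s \<in> D then (if s = a \<and> 2 * m + 1 \<in> A then px + 1 else 2)
      else 1)"

text \<open>The value 0 discards the choices that leave row \<open>a\<close> empty, since no later
  column may fill it.\<close>

definition step_wt :: "nat \<Rightarrow> nat \<Rightarrow> nat set \<Rightarrow> nat set \<Rightarrow> rat poly" where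
  "step_wt m a D A = (if a \<in> D \<union> A then \<Prod>s\<in>A. pick_wt m a D A s else 0)"

fun pick_sum :: "nat \<Rightarrow> nat \<Rightarrow> nat set \<Rightarrow> rat poly" where
  "pick_sum m 0 D = 1"
| "pick_sum m (Suc M) D = (\<Sum>A\<in>pairs (insert (2 * m + 1) (slots m (Suc M))).
     step_wt m (m - M) D A * pick_sum m M (D \<union> A))"

lemma step_wt_image:
  assumes "inj p" "p a = a" "p (2 * m + 1) = 2 * m + 1"
  shows "step_wt m a (p ` D) (p ` A) = step_wt m a D A"
proof -
  have mem: "a \<in> p ` B \<longleftrightarrow> a \<in> B" "2 * m + 1 \<in> p ` B \<longleftrightarrow> 2 * m + 1 \<in> B" for B
    using inj_image_mem_iff[OF assms(1), of a B] inj_image_mem_iff[OF assms(1), of "2 * m + 1" B]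
      assms by auto
  have eq: "p s = a \<longleftrightarrow> s = a" "p s = 2 * m + 1 \<longleftrightarrow> s = 2 * m + 1" for s
    using assms by (metis injD)+
  have "pick_wt m a (p ` D) (p ` A) (p s) = pick_wt m a D A s" for s
    using assms(1) by (simp only: pick_wt_def mem eq inj_image_mem_iff)
  moreover have "inj_on p A"
    using assms(1) by (rule inj_on_subset) simp
  ultimately show ?thesis
    by (auto simp: step_wt_def mem image_Un [symmetric] prod.reindex o_def simp del: image_Un)
qed

lemma swap_simps:
  assumes "M < K" "K < m"
  shows "swap m M (m - K) = m - K" "swap m M (2 * m + 1) = 2 * m + 1"
    "swap m M ` insert (2 * m + 1) (slots m (Suc K)) = insert (2 * m + 1) (slots m (Suc K))"
proof -
  show 1: "swap m M (m - K) = m - K" "swap m M (2 * m + 1) = 2 * m + 1"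
    using assms by (auto simp: swap_def transpose_def)
  have "swap m M ` slots m (Suc K) = slots m (Suc K)"
    unfolding swap_def using assms by (intro transpose_image_eq) (auto simp: slots_def)
  then show "swap m M ` insert (2 * m + 1) (slots m (Suc K)) = insert (2 * m + 1) (slots m (Suc K))"
    using 1 by simp
qed

lemma bij_swap: "bij (swap m M)"
  by (simp add: swap_def)

lemma bij_betw_pairs:
  assumes "bij_betw p Y Y'"
  shows "bij_betw (image p) (pairs Y) (pairs Y')"
proof -
  have inj: "inj_on p Y" and Y': "Y' = p ` Y"
    using assms by (auto simp: bij_betw_def)
  have "inj_on (image p) (pairs Y)"
    using inj_on_image_Pow[OF inj] by (rule inj_on_subset) (auto simp: pairs_def)
  moreover have "image p ` pairs Y = pairs Y'"
  proof (intro equalityI subsetI)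
    fix A assume "A \<in> image p ` pairs Y"
    then show "A \<in> pairs Y'"
      using inj unfolding pairs_def Y' by (auto simp: card_image inj_on_subset)
  next
    fix A assume A: "A \<in> pairs Y'"
    then obtain B where B: "B \<subseteq> Y" "A = p ` B"
      unfolding pairs_def Y' by (auto simp: subset_image_iff)
    moreover have "card B = card A"
      using inj B by (simp add: card_image inj_on_subset)
    ultimately show "A \<in> image p ` pairs Y"
      using A by (auto simp: pairs_def)
  qed
  ultimately show ?thesis
    by (simp add: bij_betw_def)
qed

text \<open>The swaps involved concern pairs strictly inside the pair of \<open>m - K\<close>. They
  fix \<open>m - K\<close> and \<open>2m + 1\<close> and permute the available slots, so the step
  weight is invariant and the swap can be absorbed by reindexing the sum over
  \<open>A\<close>.\<close>

lemma swap_sum_step: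
  assumes "M \<le> K" "K < m"
  shows "swap_sum m M (\<lambda>D. \<Sum>A\<in>pairs (insert (2 * m + 1) (slots m (Suc K))).
      step_wt m (m - K) D A * f (D \<union> A)) D
    = (\<Sum>A\<in>pairs (insert (2 * m + 1) (slots m (Suc K))).
      step_wt m (m - K) D A * swap_sum m M f (D \<union> A))"
  using assms(1)
proof (induction M arbitrary: D)
  case (Suc M)
  let ?P = "pairs (insert (2 * m + 1) (slots m (Suc K)))" and ?p = "swap m M"
  have inj: "inj ?p"
    using bij_swap by (rule bij_is_inj)
  have bij: "bij_betw (image ?p) ?P ?P"
    using swap_simps(3)[of M K m] Suc.prems assms inj
    by (intro bij_betw_pairs bij_betw_imageI inj_on_subset [OF inj subset_UNIV])
      (auto simp del: image_insert)
  have "(\<Sum>A\<in>?P. step_wt m (m - K) (?p ` D) A * swap_sum m M f (?p ` D \<union> A))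
      = (\<Sum>A\<in>?P. step_wt m (m - K) (?p ` D) (?p ` A) * swap_sum m M f (?p ` D \<union> ?p ` A))"
    by (rule sum.reindex_bij_betw [OF bij, symmetric])
  also have "\<dots> = (\<Sum>A\<in>?P. step_wt m (m - K) D A * swap_sum m M f (?p ` (D \<union> A)))"
    using swap_simps(1,2)[of M K m] Suc.prems assms inj
    by (intro sum.cong) (simp_all add: step_wt_image image_Un)
  finally show ?case
    using Suc by (simp add: sum.distrib distrib_left)
qed simp

text \<open>\<open>E\<close> is the value claimed for \<^const>\<open>swap_sum\<close> in \<open>swap_sum_pick_sum\<close> below. On its own this sum is
  not a multiple of \<^const>\<open>shift_iter\<close>; only its sum with the one for the exchanged state is.\<close>

lemma step_sum_eq:
  fixes m M :: nat and D :: "nat set"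
  defines "E \<equiv> \<lambda>D. 2 ^ M * 2 ^ card (D \<inter> slots m M) * shift_iter m M D 1"
  defines "c \<equiv> 2 ^ M * 2 ^ card (D \<inter> slots m M)"
  defines "Q0 \<equiv> shift_iter m M D 1"
  defines "Q1 \<equiv> \<Sum>t\<in>slots m M. shift_iter m M (insert t D) 1"
  defines "Q2 \<equiv> \<Sum>A\<in>pairs (slots m M). shift_iter m M (D \<union> A) 1"
  defines "u \<equiv> if m + 1 + M \<in> D then 2 else 1"
  assumes M: "M < m"
  shows "(\<Sum>A\<in>pairs (insert (2 * m + 1) (slots m (Suc M))). step_wt m (m - M) D A * E (D \<union> A))
    = c * (if m - M \<in> D
           then 4 * Q2 + (4 + 2 * u + 4 * px) * Q1 + (2 * u + 2 * px * (px + 1) + 2 * px * u) * Q0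
           else 2 * Q1 + (u + 2 * px) * Q0)"
proof -
  define a b i S where "a = m - M" and "b = m + 1 + M" and "i = 2 * m + 1" and "S = slots m M"
  define f where "f A = step_wt m a D A * E (D \<union> A)" for A
  define w where "w t = (if t \<in> D then 2 else 1 :: rat poly)" for t
  have fin: "finite S" and ne: "a \<notin> S" "b \<notin> S" "i \<notin> S" "a \<noteq> b" "a \<noteq> i" "b \<noteq> i"
    using M by (auto simp: S_def a_def b_def i_def slots_def)
  have neS: "t \<noteq> a" "t \<noteq> b" "t \<noteq> i" if "t \<in> S" for t
    using that ne by auto
  have pw: "pick_wt m a D A t = w t" if "t \<noteq> i" "t = a \<Longrightarrow> i \<notin> A" for t A
    using that by (auto simp: pick_wt_def i_def w_def)
  have pwi: "pick_wt m a D A i = 2 * px" for A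
    by (simp add: pick_wt_def i_def)
  have pwa: "pick_wt m a D A a = (if a \<in> D then px + 1 else 1)" if "i \<in> A" for A
    using that ne by (auto simp: pick_wt_def i_def)
  have E0: "E (D \<union> B) = c * Q0" if "B \<inter> S = {}" for B
  proof -
    have "(D \<union> B) \<inter> S = D \<inter> S" using that by auto
    moreover have "shift_iter m M (D \<union> B) 1 = Q0"
      unfolding Q0_def using that M by (intro shift_iter_cong) (auto simp: S_def)
    ultimately show ?thesis by (simp add: E_def c_def S_def)
  qed
  \<comment> \<open>The factor 2 arises either way: from \<open>w t\<close> if \<open>t\<close> is
    already used, and otherwise from the cardinality in \<open>E\<close>, which grows by
    one.\<close>
  have E1: "w t * E (insert t D \<union> B) = 2 * c * shift_iter m M (insert t D) 1"
      if "t \<in> S" "B \<inter> S = {}" for t B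
  proof -
    have "(insert t D \<union> B) \<inter> S = insert t (D \<inter> S)" using that by auto
    moreover have "shift_iter m M (insert t D \<union> B) 1 = shift_iter m M (insert t D) 1"
      using that M by (intro shift_iter_cong) (auto simp: S_def)
    ultimately show ?thesis
      using that fin by (auto simp: E_def c_def S_def w_def card_insert_if insert_absorb)
  qed
  have E2: "f A = (if a \<in> D then 4 * c * shift_iter m M (D \<union> A) 1 else 0)"
      if A_pair: "A \<in> pairs S" for A
  proof -
    obtain s t where A: "A = {s, t}" "s \<noteq> t" "s \<in> S" "t \<in> S"
      using A_pair unfolding pairs_def card_2_iff by blast
    have "(D \<union> A) \<inter> S = insert s (insert t (D \<inter> S))" using A by auto
    then have "w s * w t * E (D \<union> A) = 4 * c * shift_iter m M (D \<union> A) 1"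
      using A fin by (auto simp: E_def c_def S_def w_def card_insert_if insert_absorb)
    then show ?thesis
      using A neS[of s] neS[of t] ne by (simp add: f_def step_wt_def pw)
  qed
  have ft: "f {s, t} = (if a \<in> D \<or> s = a then v * (2 * c * shift_iter m M (insert t D) 1) else 0)"
    if "t \<in> S" "s \<in> {a, b, i}" "v = (if s = i then 2 * px else w s)" for s t v
  proof -
    have "w t * E (D \<union> {s, t}) = 2 * c * shift_iter m M (insert t D) 1"
      using E1[of t "{s}"] that ne by (auto simp: insert_commute)
    then have "v * (w t * E (D \<union> {s, t})) = v * (2 * c * shift_iter m M (insert t D) 1)"
      by simp
    moreover have "step_wt m a D {s, t} = (if a \<in> D \<or> s = a then v * w t else 0)"
      using that ne neS[of t] by (auto simp: step_wt_def pw pwi)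
    ultimately show ?thesis
      by (simp add: f_def mult.assoc)
  qed
  have fai: "f {a, b} = w a * u * (c * Q0)" "f {i, b}
      = (if a \<in> D then 2 * px * u * (c * Q0) else 0)"
    "f {i, a} = 2 * px * (if a \<in> D then px + 1 else 1) * (c * Q0)"
    using ne E0[of "{a, b}"] E0[of "{i, b}"] E0[of "{i, a}"]
    by (auto simp: f_def step_wt_def pw pwi pwa w_def u_def b_def)
  have sum1: "(\<Sum>t\<in>S. f {s, t}) = (if a \<in> D \<or> s = a then v * (2 * c * Q1) else 0)"
    if "s \<in> {a, b, i}" "v = (if s = i then 2 * px else w s)" for s v
    using ft[OF _ that] by (simp add: Q1_def S_def sum_distrib_left)
  have "(\<Sum>A\<in>pairs (insert (2 * m + 1) (slots m (Suc M))). step_wt m (m - M) D A * E (D \<union> A))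
      = sum f (pairs (insert i (insert a (insert b S))))"
    using M by (simp add: f_def slots_Suc a_def b_def i_def S_def)
  \<comment> \<open>The pairs are sorted by which of the special slots \<open>i\<close>,
    \<open>a\<close>, \<open>b\<close> they contain.\<close>
  also have "\<dots> = sum f (pairs S) + (\<Sum>t\<in>S. f {b, t}) + (f {a, b} + (\<Sum>t\<in>S. f {a, t}))
      + (f {i, a} + (f {i, b} + (\<Sum>t\<in>S. f {i, t})))"
    using fin ne by (simp add: sum_pairs_insert)
  also have "sum f (pairs S) = (if a \<in> D then 4 * c * Q2 else 0)"
    by (simp add: E2 Q2_def S_def sum_distrib_left)
  also have "(\<Sum>t\<in>S. f {b, t}) = (if a \<in> D then u * (2 * c * Q1) else 0)"
    using ne by (subst sum1[of b u]) (auto simp: u_def w_def b_def)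
  also have "(\<Sum>t\<in>S. f {a, t}) = w a * (2 * c * Q1)"
    using ne by (subst sum1[of a "w a"]) auto
  also have "(\<Sum>t\<in>S. f {i, t}) = (if a \<in> D then 2 * px * (2 * c * Q1) else 0)"
    using ne by (subst sum1[of i "2 * px"]) auto
  finally show ?thesis
    unfolding fai by (simp add: w_def a_def [symmetric] algebra_simps)
qed

text \<open>The inner swaps pass through the choice for column \<open>m - M\<close> by
  \<open>swap_sum_step\<close>, and the induction hypothesis evaluates what follows. The last swap
  adds the sums for \<open>D\<close> and its image \<open>D'\<close>, which agree on
  \<open>slots m M\<close> and exchange the membership of the two slots of the outermost pair. Their
  total is compared with \<open>shift_iter_hit\<close> or \<open>shift_iter_not_hit\<close>.\<close>

lemma swap_sum_pick_sum:
  assumes "M \<le> m"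
  shows "swap_sum m M (pick_sum m M) D = 2 ^ M * 2 ^ card (D \<inter> slots m M) * shift_iter m M D 1"
  using assms
proof (induction M arbitrary: D)
  case (Suc M)
  define a b S D' where "a = m - M" and "b = m + 1 + M" and "S = slots m M"
    and "D' = swap m M ` D"
  define c Q0 Q1 Q2 where "c = (2 :: rat poly) ^ M * 2 ^ card (D \<inter> S)"
    and "Q0 = shift_iter m M D 1" and "Q1 = (\<Sum>t\<in>S. shift_iter m M (insert t D) 1)"
    and "Q2 = (\<Sum>A\<in>pairs S. shift_iter m M (D \<union> A) 1)"
  have M: "M < m" and fin: "finite S" and ne: "a \<notin> S" "b \<notin> S" "a \<noteq> b"
    using Suc.prems by (auto simp: S_def a_def b_def slots_def)
  have swap: "swap m M = transpose a b"
    by (simp add: swap_def a_def b_def)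
  have D'S: "D' \<inter> S = D \<inter> S"
    using ne by (auto simp: D'_def swap transpose_def image_iff split: if_splits)
  have D'ab: "a \<in> D' \<longleftrightarrow> b \<in> D" "b \<in> D' \<longleftrightarrow> a \<in> D"
    by (auto simp: D'_def swap transpose_def image_iff split: if_splits)
  have shift_iter_eq: "shift_iter m M (D' \<union> A) 1 = shift_iter m M (D \<union> A) 1" for A
    using D'S M by (intro shift_iter_cong) (auto simp: S_def)
  have *: "swap_sum m M (pick_sum m (Suc M)) B
    = (\<Sum>A\<in>pairs (insert (2 * m + 1) (slots m (Suc M))). step_wt m (m - M) B A *
        (2 ^ M * 2 ^ card ((B \<union> A) \<inter> slots m M) * shift_iter m M (B \<union> A) 1))" for B
  proof -
    have "swap_sum m M (pick_sum m (Suc M)) B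
        = (\<Sum>A\<in>pairs (insert (2 * m + 1) (slots m (Suc M))).
            step_wt m (m - M) B A * swap_sum m M (pick_sum m M) (B \<union> A))"
      unfolding swap_sum_step [OF order_refl M, symmetric]
      by (intro arg_cong [where f = "\<lambda>f. swap_sum m M f B"]) (simp add: fun_eq_iff)
    then show ?thesis using Suc by simp
  qed
  have "swap_sum m (Suc M) (pick_sum m (Suc M)) D
      = swap_sum m M (pick_sum m (Suc M)) D + swap_sum m M (pick_sum m (Suc M)) D'"
    by (simp add: D'_def)
  also have "swap_sum m M (pick_sum m (Suc M)) D = c *
      (if a \<in> D
       then 4 * Q2 + (4 + 2 * (if b \<in> D then 2 else 1) + 4 * px) * Q1
         + (2 * (if b \<in> D then 2 else 1) + 2 * px * (px + 1)
             + 2 * px * (if b \<in> D then 2 else 1)) * Q0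
       else 2 * Q1 + ((if b \<in> D then 2 else 1) + 2 * px) * Q0)"
    unfolding * step_sum_eq[OF M] c_def Q0_def Q1_def Q2_def S_def a_def b_def by (rule refl)
  also have "swap_sum m M (pick_sum m (Suc M)) D' = c *
      (if b \<in> D
       then 4 * Q2 + (4 + 2 * (if a \<in> D then 2 else 1) + 4 * px) * Q1
         + (2 * (if a \<in> D then 2 else 1) + 2 * px * (px + 1)
             + 2 * px * (if a \<in> D then 2 else 1)) * Q0
       else 2 * Q1 + ((if a \<in> D then 2 else 1) + 2 * px) * Q0)"
    unfolding * step_sum_eq[OF M]
    unfolding a_def [symmetric] b_def [symmetric] S_def [symmetric] D'S D'ab
    using shift_iter_eq[of "{}"] shift_iter_eq[of "{_}"] shift_iter_eq
    by (simp add: c_def Q0_def Q1_def Q2_def)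
  also have "c * (if a \<in> D
       then 4 * Q2 + (4 + 2 * (if b \<in> D then 2 else 1) + 4 * px) * Q1
         + (2 * (if b \<in> D then 2 else 1) + 2 * px * (px + 1)
             + 2 * px * (if b \<in> D then 2 else 1)) * Q0
       else 2 * Q1 + ((if b \<in> D then 2 else 1) + 2 * px) * Q0) + c *
      (if b \<in> D
       then 4 * Q2 + (4 + 2 * (if a \<in> D then 2 else 1) + 4 * px) * Q1
         + (2 * (if a \<in> D then 2 else 1) + 2 * px * (px + 1)
             + 2 * px * (if a \<in> D then 2 else 1)) * Q0
       else 2 * Q1 + ((if a \<in> D then 2 else 1) + 2 * px) * Q0)
    = 2 * ((if a \<in> D then 2 else 1) * ((if b \<in> D then 2 else 1) * c)) * shift_iter m (Suc M) D 1"
  proof (cases "hit m M D")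
    case True
    then have iter_eq: "2 * shift_iter m (Suc M) D 1
        = (px + 1) * (px + 2) * Q0 + 2 * (px + 2) * Q1 + 2 * Q2"
      using shift_iter_hit[OF M True] by (simp add: Q0_def Q1_def Q2_def S_def)
    from True consider "a \<in> D" "b \<in> D" | "a \<in> D" "b \<notin> D" | "a \<notin> D" "b \<in> D"
      by (auto simp: hit_def a_def b_def)
    then show ?thesis
      by cases (use iter_eq in \<open>simp_all del: shift_iter.simps, algebra+\<close>)
  next
    case False
    then have iter_eq: "shift_iter m (Suc M) D 1 = (2 * px + 1) * Q0 + 2 * Q1"
      using shift_iter_not_hit[OF M False] by (simp add: Q0_def Q1_def S_def)
    from False show ?thesis
      unfolding iter_eq by (simp add: hit_def a_def b_def algebra_simps)
  qed
  also have "\<dots> = 2 ^ Suc M * 2 ^ card (D \<inter> slots m (Suc M)) * shift_iter m (Suc M) D 1"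
  proof -
    have "D \<inter> slots m (Suc M) = (if a \<in> D then {a} else {})
        \<union> ((if b \<in> D then {b} else {}) \<union> (D \<inter> S))"
      using M by (auto simp: slots_Suc a_def b_def S_def)
    then show ?thesis
      using ne fin by (simp add: c_def card_insert_if)
  qed
  finally show ?case .
qed simp

text \<open>All swaps fix the empty state, so averaging does not change \<open>pick_sum\<close>
  there, and the factor \<open>2 ^ m\<close> cancels.\<close>

lemma pick_sum_empty: "pick_sum m m {} = Pn (Suc m)"
proof -
  have "swap_sum m M f {} = 2 ^ M * f {}" for M f
    by (induction M) simp_all
  then have "2 ^ m * pick_sum m m {} = 2 ^ m * shift_iter m m {} 1"
    using swap_sum_pick_sum[of m m "{}"] by simp
  then show ?thesis
    using shift_iter_empty_Pn[of m m 0] by simp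
qed

subsection \<open>Iterating a partial injection\<close>

definition limit_point :: "('a \<Rightarrow> 'a) \<Rightarrow> 'a \<Rightarrow> 'a" where
  "limit_point f i = (THE r. \<exists>N. \<forall>k\<ge>N. (f ^^ k) i = r)"

lemma limit_point_eq:
  assumes "f ((f ^^ N) i) = (f ^^ N) i"
  shows "limit_point f i = (f ^^ N) i"
proof -
  have const: "(f ^^ k) i = (f ^^ N) i" if "k \<ge> N" for k
    using that by (induction k rule: dec_induct) (simp_all add: assms)
  show ?thesis
    unfolding limit_point_def
  proof (rule the_equality)
    fix r assume "\<exists>N. \<forall>k\<ge>N. (f ^^ k) i = r"
    then obtain N' where "\<forall>k\<ge>N'. (f ^^ k) i = r" ..
    then have "(f ^^ max N N') i = r" by simp
    then show "r = (f ^^ N) i" using const[of "max N N'"] by simp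
  qed (use const in blast)
qed

locale partial_injection =
  fixes f :: "'a \<Rightarrow> 'a" and U L :: "'a set"
  assumes finite_U: "finite U" and L_sub: "L \<subseteq> U" and inj_L: "inj_on f L"
    and image_L: "f ` L \<subseteq> U" and fixed: "i \<in> U - L \<Longrightarrow> f i = i"
begin

text \<open>Before they meet both orbits run inside \<open>L\<close>, so injectivity on
  \<open>L\<close> allows the last \<open>d\<close> steps to be undone in parallel.\<close>

lemma funpow_cancel:
  assumes "\<forall>n<a. (f ^^ n) i \<in> L" "\<forall>n<b. (f ^^ n) i' \<in> L" "(f ^^ a) i = (f ^^ b) i'"
    and "d \<le> a" "d \<le> b"
  shows "(f ^^ (a - d)) i = (f ^^ (b - d)) i'"
  using assms(4,5)
proof (induction d)
  case (Suc d)
  have "a - d = Suc (a - Suc d)" "b - d = Suc (b - Suc d)"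
    using Suc.prems by simp_all
  then have "(f ^^ (a - d)) i = f ((f ^^ (a - Suc d)) i)"
      "(f ^^ (b - d)) i' = f ((f ^^ (b - Suc d)) i')"
    by simp_all
  moreover have "(f ^^ (a - Suc d)) i \<in> L" "(f ^^ (b - Suc d)) i' \<in> L"
    using assms(1,2) Suc.prems by auto
  ultimately show ?case
    using Suc inj_L by (auto dest: inj_onD)
qed (use assms(3) in simp)

text \<open>An orbit that never left \<open>L\<close> would repeat a value; undoing steps then
  returns it to its start, which would make \<open>i\<close> an image of a point of
  \<open>L\<close>.\<close>

lemma exits:
  assumes "i \<in> U - f ` L"
  shows "\<exists>N. (f ^^ N) i \<in> U - L \<and> (\<forall>n<N. (f ^^ n) i \<in> L)"
proof -
  have in_U: "(f ^^ n) i \<in> U" for n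
  proof (induction n)
    case (Suc n)
    then show ?case
      using image_L fixed[of "(f ^^ n) i"] by (cases "(f ^^ n) i \<in> L") auto
  qed (use assms in simp)
  have "\<exists>n. (f ^^ n) i \<notin> L"
  proof (rule ccontr)
    assume "\<not> (\<exists>n. (f ^^ n) i \<notin> L)"
    then have L: "(f ^^ n) i \<in> L" for n by simp
    have "finite (range (\<lambda>n. (f ^^ n) i))"
      using finite_U by (rule finite_subset [rotated]) (use in_U in blast)
    then have "\<not> inj (\<lambda>n. (f ^^ n) i)"
      using range_inj_infinite by blast
    then obtain a b where "a < b" "(f ^^ a) i = (f ^^ b) i"
      by (auto simp: inj_def) (metis linorder_neqE_nat)
    then have "i = (f ^^ (b - a)) i"
      using funpow_cancel[of a i b i a] L by simp
    moreover obtain d where "b - a = Suc d"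
      using \<open>a < b\<close> by (metis Suc_diff_Suc)
    ultimately have "i = f ((f ^^ d) i)"
      by simp
    then show False
      using L[of d] assms by blast
  qed
  then show ?thesis
    using in_U exists_least_iff[of "\<lambda>n. (f ^^ n) i \<notin> L"] by auto
qed

lemma limit_point_exits:
  assumes "i \<in> U - f ` L"
  obtains N where "limit_point f i = (f ^^ N) i" "(f ^^ N) i \<in> U - L" "\<forall>n<N. (f ^^ n) i \<in> L"
  using exits[OF assms] limit_point_eq fixed by metis

lemma limit_point_fixed: "i \<in> U - L \<Longrightarrow> limit_point f i = i"
  using limit_point_eq[of f 0 i] fixed by simp

lemma bij_betw_limit_point: "bij_betw (limit_point f) (U - f ` L) (U - L)"
proof -
  have *: "i = i'"
    if "i \<in> U - f ` L" "a \<le> b" "(f ^^ a) i = (f ^^ b) i'"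
      "\<forall>n<a. (f ^^ n) i \<in> L" "\<forall>n<b. (f ^^ n) i' \<in> L" for i i' a b
  proof -
    have i: "i = (f ^^ (b - a)) i'"
      using funpow_cancel[of a i b i' a] that by simp
    show ?thesis
    proof (cases "a < b")
      case True
      then obtain d where d: "b - a = Suc d"
        by (metis Suc_diff_Suc)
      then have "i = f ((f ^^ d) i')" "(f ^^ d) i' \<in> L"
        using i that(5) by simp_all
      then show ?thesis
        using that(1) by blast
    qed (use i that in simp)
  qed
  have inj: "inj_on (limit_point f) (U - f ` L)"
  proof (rule inj_onI)
    fix i i' assume i: "i \<in> U - f ` L" "i' \<in> U - f ` L" "limit_point f i = limit_point f i'"
    obtain a where a: "limit_point f i = (f ^^ a) i" "\<forall>n<a. (f ^^ n) i \<in> L"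
      using limit_point_exits[OF i(1)] .
    obtain b where b: "limit_point f i' = (f ^^ b) i'" "\<forall>n<b. (f ^^ n) i' \<in> L"
      using limit_point_exits[OF i(2)] .
    show "i = i'"
      using *[of i a b i'] *[of i' b a i] a b i by (metis nle_le)
  qed
  have "limit_point f ` (U - f ` L) \<subseteq> U - L"
    using limit_point_exits by (metis image_subsetI)
  moreover have "card (limit_point f ` (U - f ` L)) = card (U - L)"
    using inj finite_U L_sub image_L inj_L
    by (simp add: card_image card_Diff_subset finite_subset)
  ultimately show ?thesis
    using inj finite_U by (simp add: bij_betw_def card_subset_eq)
qed

end

subsection \<open>The root map of a placement\<close>

text \<open>These are the first \<open>k\<close> columns of a placement under construction. Rows
  \<open>1, ..., k\<close> must already be full, because \<open>j \<le> i\<close> keeps every later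
  column out of them.\<close>

definition partial_placements :: "nat \<Rightarrow> nat \<Rightarrow> point set set" where
  "partial_placements m k = {T. T \<subseteq> {1..k} \<times> {1..2 * m + 1}
     \<and> (\<forall>j\<in>{1..k}. card {i. (j, i) \<in> T} = 2)
     \<and> inj_on snd T \<and> {1..k} \<subseteq> snd ` T \<and> (\<forall>(j, i)\<in>T. j \<le> i)}"

lemma placements_eq: "placements m = partial_placements m m"
proof -
  have fin: "finite {j. (j, i) \<in> T}" if "T \<subseteq> {1..m} \<times> {1..2 * m + 1}" for T :: "point set" and i
    by (rule finite_subset [of _ "{1..m}"]) (use that in auto)
  have 1: "inj_on snd T \<longleftrightarrow> (\<forall>i\<in>{1..2 * m + 1}. card {j. (j, i) \<in> T} \<le> 1)"
    if T: "T \<subseteq> {1..m} \<times> {1..2 * m + 1}" for T :: "point set"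
  proof -
    have "card {j. (j, i) \<in> T} \<le> 1 \<longleftrightarrow> (\<forall>j j'. (j, i) \<in> T \<longrightarrow> (j', i) \<in> T \<longrightarrow> j = j')" for i
      using card_le_Suc0_iff_eq[OF fin[OF T]] by auto
    then show ?thesis
      using T by (fastforce simp: inj_on_def)
  qed
  have 2: "{1..m} \<subseteq> snd ` T \<longleftrightarrow> (\<forall>i\<in>{1..m}. card {j. (j, i) \<in> T} = 1)"
    if T: "T \<subseteq> {1..m} \<times> {1..2 * m + 1}"
      and le: "\<forall>i\<in>{1..2 * m + 1}. card {j. (j, i) \<in> T} \<le> 1" for T :: "point set"
  proof -
    have "i \<in> snd ` T \<longleftrightarrow> card {j. (j, i) \<in> T} = 1" if "i \<in> {1..m}" for i
    proof -
      have "i \<in> snd ` T \<longleftrightarrow> card {j. (j, i) \<in> T} \<noteq> 0"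
        using fin[OF T] by (force simp: card_eq_0_iff)
      moreover have "card {j. (j, i) \<in> T} \<le> 1"
        using le that by simp
      ultimately show ?thesis by linarith
    qed
    then show ?thesis by blast
  qed
  show ?thesis
    unfolding placements_def partial_placements_def
  proof (rule Collect_cong)
    fix T :: "point set"
    show "(T \<subseteq> {1..m} \<times> {1..2 * m + 1} \<and> (\<forall>j\<in>{1..m}. card {i. (j, i) \<in> T} = 2)
       \<and> (\<forall>i\<in>{1..2 * m + 1}. card {j. (j, i) \<in> T} \<le> 1)
       \<and> (\<forall>i\<in>{1..m}. card {j. (j, i) \<in> T} = 1) \<and> (\<forall>(j, i)\<in>T. j \<le> i))
     \<longleftrightarrow> (T \<subseteq> {1..m} \<times> {1..2 * m + 1} \<and> (\<forall>j\<in>{1..m}. card {i. (j, i) \<in> T} = 2)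
       \<and> inj_on snd T \<and> {1..m} \<subseteq> snd ` T \<and> (\<forall>(j, i)\<in>T. j \<le> i))"
      using 1[of T] 2[of T] by satx
  qed
qed

section \<open>Root steps as a bijection from labels to occupied rows\<close>

definition occupied :: "point set \<Rightarrow> nat \<Rightarrow> nat set" where
  "occupied T j = {i. \<exists>c<j. (c, i) \<in> T}"

text \<open>The rows moved by \<open>root_step\<close> for column \<open>j\<close>: each earlier
  column \<open>c\<close> owns the label \<open>c\<close> for its lower point and
  \<open>2m + 1 - c\<close> for its upper point.\<close>

definition labels :: "nat \<Rightarrow> nat \<Rightarrow> nat set" where
  "labels m j = {1..<j} \<union> {2 * m + 2 - j..2 * m}"

lemma rows_minus_labels:
  assumes "1 \<le> j" "j \<le> Suc m"
  shows "{1..2 * m + 1} - labels m j = insert (2 * m + 1) (slots m (Suc m - j))"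
  using assms by (auto simp: labels_def slots_def)

lemma root_row_eq: "root_row m T (j, i) = limit_point (root_step m T j) i"
  by (simp add: root_row_def limit_point_def)

lemma root_step_low: "\<lbrakk>1 \<le> c; c < j; j \<le> Suc m\<rbrakk> \<Longrightarrow> root_step m T j c = lower_row T c"
  by (auto simp: root_step_def)

lemma root_step_high:
  "\<lbrakk>1 \<le> c; c < j; j \<le> Suc m\<rbrakk> \<Longrightarrow> root_step m T j (2 * m + 1 - c) = upper_row T c"
  by (auto simp: root_step_def)

lemma labels_cases:
  assumes "i \<in> labels m j" "j \<le> Suc m"
  obtains c where "1 \<le> c" "c < j" "i = c" | c where "1 \<le> c" "c < j" "i = 2 * m + 1 - c"
proof (cases "i < j")
  case True
  then show ?thesis using assms that(1)[of i] by (auto simp: labels_def)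
next
  case False
  then show ?thesis using assms that(2)[of "2 * m + 1 - i"] by (auto simp: labels_def)
qed

context
  fixes m k :: nat and T :: "point set"
  assumes T: "T \<in> partial_placements m k" and k: "k \<le> m"
begin

lemma column_obtain:
  assumes "j \<in> {1..k}"
  obtains "{i. (j, i) \<in> T} = {lower_row T j, upper_row T j}" "lower_row T j < upper_row T j"
proof -
  have "card {i. (j, i) \<in> T} = 2"
    using T assms by (simp add: partial_placements_def)
  then obtain a b where *: "{i. (j, i) \<in> T} = {a, b}" "a < b"
    by (metis card_2_iff doubleton_eq_iff linorder_neqE_nat)
  then have "lower_row T j = a" "upper_row T j = b"
    by (simp_all add: lower_row_def upper_row_def)
  with * that show thesis by simp
qed

lemma in_column: "j \<in> {1..k} \<Longrightarrow> (j, i) \<in> T \<longleftrightarrow> i = lower_row T j \<or> i = upper_row T j"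
proof -
  assume "j \<in> {1..k}"
  then have "{i. (j, i) \<in> T} = {lower_row T j, upper_row T j}"
    using column_obtain by blast
  then have "i \<in> {i. (j, i) \<in> T} \<longleftrightarrow> i \<in> {lower_row T j, upper_row T j}"
    by (rule arg_cong)
  then show ?thesis by simp
qed

lemma lower_less_upper: "j \<in> {1..k} \<Longrightarrow> lower_row T j < upper_row T j"
  using column_obtain[of j] by blast

lemma point_range: "(j, i) \<in> T \<Longrightarrow> j \<in> {1..k} \<and> i \<in> {1..2 * m + 1} \<and> j \<le> i"
proof -
  assume p: "(j, i) \<in> T"
  have "T \<subseteq> {1..k} \<times> {1..2 * m + 1}" "\<forall>(j, i)\<in>T. j \<le> i"
    using T by (simp_all add: partial_placements_def)
  with p show ?thesis by blast
qed

lemma same_row: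
  assumes "(j, i) \<in> T" "(j', i) \<in> T"
  shows "j = j'"
proof -
  have "inj_on snd T"
    using T by (simp only: partial_placements_def mem_Collect_eq)
  from inj_onD[OF this _ assms] show ?thesis by simp
qed

lemma finite_placement: "finite T"
  using point_range by (intro finite_subset [of T "{1..k} \<times> {1..2 * m + 1}"]) auto

lemma root_step_labels:
  assumes "j \<le> Suc k"
  shows "root_step m T j ` labels m j = occupied T j"
proof (intro equalityI subsetI)
  fix i assume "i \<in> root_step m T j ` labels m j"
  then obtain l where l: "l \<in> labels m j" "i = root_step m T j l" by blast
  have jm: "j \<le> Suc m" using assms k by simp
  from l(1) jm show "i \<in> occupied T j"
  proof (cases rule: labels_cases)
    case (1 c)
    then have "(c, i) \<in> T"
      using l(2) jm assms by (simp add: root_step_low in_column)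
    with 1 show ?thesis by (auto simp: occupied_def)
  next
    case (2 c)
    then have "(c, i) \<in> T"
      using l(2) jm assms root_step_high[of c j] by (simp add: in_column)
    with 2 show ?thesis by (auto simp: occupied_def)
  qed
next
  fix i assume "i \<in> occupied T j"
  then obtain c where c: "c < j" "(c, i) \<in> T" by (auto simp: occupied_def)
  then have c': "c \<in> {1..k}" using point_range by blast
  with c have "i = lower_row T c \<or> i = upper_row T c" by (simp add: in_column)
  moreover have "c \<in> labels m j" "2 * m + 1 - c \<in> labels m j"
    using c c' assms k by (auto simp: labels_def)
  moreover have "root_step m T j c = lower_row T c"
      "root_step m T j (2 * m + 1 - c) = upper_row T c"
    using c c' assms k root_step_low[of c j] root_step_high[of c j] by simp_all
  ultimately show "i \<in> root_step m T j ` labels m j"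
    by (metis imageI)
qed

lemma inj_on_root_step:
  assumes "j \<le> Suc k"
  shows "inj_on (root_step m T j) (labels m j)"
proof (rule inj_onI)
  fix x y assume x: "x \<in> labels m j" and y: "y \<in> labels m j"
    and eq: "root_step m T j x = root_step m T j y"
  have jm: "j \<le> Suc m" using assms k by simp
  have *: "\<exists>c. c \<in> {1..k} \<and> (c, root_step m T j l) \<in> T \<and>
      (l = c \<and> root_step m T j l = lower_row T c \<or>
       l = 2 * m + 1 - c \<and> root_step m T j l = upper_row T c)" if "l \<in> labels m j" for l
    using that jm
  proof (cases rule: labels_cases)
    case (1 c)
    then show ?thesis
      using jm assms by (intro exI[of _ c]) (simp add: root_step_low in_column)
  next
    case (2 c)
    then show ?thesis
      using jm assms root_step_high[of c j] by (intro exI[of _ c]) (simp add: in_column)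
  qed
  from *[OF x] *[OF y] eq same_row lower_less_upper show "x = y"
    by (metis less_irrefl)
qed

lemma partial_injection:
  assumes "1 \<le> j" "j \<le> Suc k"
  shows "partial_injection (root_step m T j) {1..2 * m + 1} (labels m j)"
proof
  show "labels m j \<subseteq> {1..2 * m + 1}"
    using assms k by (auto simp: labels_def)
  show "root_step m T j ` labels m j \<subseteq> {1..2 * m + 1}"
    unfolding root_step_labels[OF assms(2)] using point_range by (auto simp: occupied_def)
  show "root_step m T j i = i" if "i \<in> {1..2 * m + 1} - labels m j" for i
    using that by (auto simp: labels_def root_step_def)
qed (use assms inj_on_root_step in auto)

text \<open>\<open>root_step\<close> maps the labels injectively onto the occupied rows and fixes
  the slots, so this is \<open>bij_betw_limit_point\<close> with \<open>L\<close> the set of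
  labels.\<close>

lemma bij_betw_root_row:
  assumes "1 \<le> j" "j \<le> Suc k"
  shows "bij_betw (\<lambda>i. root_row m T (j, i)) ({1..2 * m + 1} - occupied T j)
    (insert (2 * m + 1) (slots m (Suc m - j)))"
proof -
  have "j \<le> Suc m"
    using assms k by simp
  then show ?thesis
    using partial_injection.bij_betw_limit_point[OF partial_injection[OF assms]] assms
    by (simp only: root_row_eq root_step_labels rows_minus_labels)
qed

lemma root_row_slot:
  assumes "1 \<le> j" "j \<le> Suc k" "i \<in> insert (2 * m + 1) (slots m (Suc m - j))"
  shows "root_row m T (j, i) = i"
  using partial_injection.limit_point_fixed[OF partial_injection[OF assms(1,2)], of i] assms k
  by (simp only: root_row_eq rows_minus_labels)

lemma point_not_occupied: "(j, i) \<in> T \<Longrightarrow> i \<in> {1..2 * m + 1} - occupied T j"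
  using point_range same_row by (fastforce simp: occupied_def)

end

subsection \<open>The path from the top row\<close>

definition is_record :: "(nat \<Rightarrow> nat) \<Rightarrow> nat \<Rightarrow> bool" where
  "is_record c k \<longleftrightarrow> (\<forall>k'<k. c k' < c k)"

text \<open>The successive \<open>LEAST\<close> choices skip no strict left-to-right maximum, and
  the last one is where the overall maximum is first attained.\<close>

lemma record_index_bij_betw:
  fixes m :: nat and T :: "point set" and p :: point
  defines "c \<equiv> path_col m T p"
  assumes fin: "finite (range c)"
  shows "bij_betw (record_index m T p) {..last_record m T p} {k. is_record c k}"
proof -
  let ?r = "record_index m T p" and ?M = "Max (range c)" and ?l = "last_record m T p"
  have le_M: "c k \<le> ?M" for k
    using fin by simp
  have r_Suc: "?r (Suc q) = (LEAST k. k > ?r q \<and> c k > c (?r q))" for q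
    by (simp add: c_def)
  have step: "?r q < ?r (Suc q) \<and> is_record c (?r (Suc q)) \<and> c (?r q) < c (?r (Suc q))
      \<and> (\<forall>k. ?r q < k \<and> k < ?r (Suc q) \<longrightarrow> \<not> is_record c k)"
    if rec: "is_record c (?r q)" and ne: "c (?r q) \<noteq> ?M" for q
  proof -
    have less: "c (?r q) < ?M"
      using le_M[of "?r q"] ne by simp
    obtain k where k: "c k = ?M"
      using Max_in[OF fin] by auto
    then have "\<not> k \<le> ?r q"
      using rec less unfolding is_record_def by (metis le_neq_implies_less less_irrefl less_trans)
    with k less have "k > ?r q \<and> c k > c (?r q)"
      by simp
    then have r: "?r q < ?r (Suc q)" "c (?r q) < c (?r (Suc q))"
      unfolding r_Suc by (metis (mono_tags, lifting) LeastI)+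
    have between: "c k \<le> c (?r q)" if "?r q < k" "k < ?r (Suc q)" for k
      using not_less_Least[OF that(2) [unfolded r_Suc]] that(1) by simp
    have "c k < c (?r (Suc q))" if "k < ?r (Suc q)" for k
      using rec r(2) between[of k] that unfolding is_record_def
      by (metis le_less_trans less_trans linorder_neqE_nat)
    moreover have "\<not> is_record c k" if "?r q < k" "k < ?r (Suc q)" for k
      using between[OF that] that unfolding is_record_def by (metis leD)
    ultimately show ?thesis
      using r by (auto simp: is_record_def)
  qed
  \<comment> \<open>Otherwise the records would go on forever; as their columns increase strictly,
    the record with index \<open>q\<close> would lie in a column at least \<open>q\<close>, which
    exceeds the maximum.\<close>
  have "\<exists>q. c (?r q) = ?M"
  proof (rule ccontr)
    assume no: "\<nexists>q. c (?r q) = ?M"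
    have "is_record c (?r q) \<and> q \<le> c (?r q)" for q
    proof (induction q)
      case (Suc q)
      with step[of q] no show ?case
        by (metis Suc_leI le_less_trans)
    qed (simp add: is_record_def)
    then have "Suc ?M \<le> c (?r (Suc ?M))" by blast
    with le_M[of "?r (Suc ?M)"] show False by simp
  qed
  then have last: "c (?r ?l) = ?M"
    unfolding last_record_def c_def [symmetric] by (metis (mono_tags, lifting) LeastI)
  have not_last: "c (?r q) \<noteq> ?M" if "q < ?l" for q
    using that unfolding last_record_def c_def [symmetric]
    by (metis (mono_tags, lifting) not_less_Least)
  have rec: "is_record c (?r q)" if "q \<le> ?l" for q
    using that
  proof (induction q)
    case (Suc q)
    then show ?case using step[of q] not_last[of q] by simp
  qed (simp add: is_record_def)
  have "?r q < ?r q'" if "q < q'" "q' \<le> ?l" for q q'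
    using that
  proof (induction q' rule: less_induct)
    case (less q')
    then obtain s where s: "q' = Suc s" "q \<le> s" by (cases q') auto
    then have "s < ?l" "q \<noteq> s \<Longrightarrow> ?r q < ?r s"
      using less.prems less.IH[of s] by simp_all
    moreover from this have "?r s < ?r q'"
      using step[of s] not_last[of s] rec[of s] s(1) by (simp del: record_index.simps)
    ultimately show ?case
      by (metis less_trans)
  qed
  then have inj: "inj_on ?r {..?l}"
    by (intro strict_mono_on_imp_inj_on strict_mono_onI) simp
  have cover: "k \<in> ?r ` {..q}" if "is_record c k" "k \<le> ?r q" "q \<le> ?l" for k q
    using that(2,3)
  proof (induction q)
    case (Suc q)
    have "\<not> (?r q < k \<and> k < ?r (Suc q))"
      using step[of q] not_last[of q] rec[of q] that(1) Suc.prems by auto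
    then consider "k \<le> ?r q" | "k = ?r (Suc q)"
      using Suc.prems by linarith
    then show ?case
    proof cases
      case 1
      then have "k \<in> ?r ` {..q}" using Suc by simp
      then show ?thesis by (auto simp del: record_index.simps)
    next
      case 2
      then show ?thesis by (intro image_eqI[of _ _ "Suc q"]) simp_all
    qed
  qed simp
  have "k \<le> ?r ?l" if "is_record c k" for k
    using that le_M[of k] last unfolding is_record_def by (metis leD leI)
  then have "k \<in> ?r ` {..?l}" if "is_record c k" for k
    using cover[OF that _ order_refl] that by simp
  moreover have "is_record c k" if k: "k \<in> ?r ` {..?l}" for k
  proof -
    from k obtain q where "k = ?r q" "q \<le> ?l" by blast
    with rec show ?thesis by simp
  qed
  ultimately have "?r ` {..?l} = {k. is_record c k}"
    by (intro equalityI subsetI) simp_all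
  with inj show ?thesis
    by (simp add: bij_betw_def)
qed

section \<open>The points of \<open>V(T)\<close> as the points with root
  \<open>2m + 1\<close>\<close>

definition root_points :: "nat \<Rightarrow> point set \<Rightarrow> point set" where
  "root_points m T = {p \<in> T. root_row m T p = 2 * m + 1}"

context
  fixes m :: nat and T :: "point set"
  assumes T: "T \<in> partial_placements m m"
begin

lemma row_point:
  assumes "\<not> row_empty T i"
  shows "row_point T i \<in> T" "snd (row_point T i) = i"
proof -
  obtain j where j: "(j, i) \<in> T"
    using assms by (auto simp: row_empty_def)
  have "row_point T i = (j, i)"
    unfolding row_point_def using j same_row[OF T order_refl] by (intro the_equality) auto
  with j show "row_point T i \<in> T" "snd (row_point T i) = i"
    by simp_all
qed

lemma row_point_eq:
  assumes "(j, i) \<in> T"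
  shows "row_point T i = (j, i)"
proof -
  have "\<not> row_empty T i"
    using assms by (auto simp: row_empty_def)
  from row_point[OF this] same_row[OF T order_refl assms] show ?thesis
    by (cases "row_point T i") auto
qed

text \<open>As long as the path stays in columns below \<open>j\<close>,
  \<open>root_step m T j\<close> undoes \<open>path_step\<close>. The root iteration from a record
  in column \<open>j\<close> therefore retraces the path to the top row; conversely, a root
  iteration reaching the top row is a path read backwards through columns below \<open>j\<close>, so
  its starting point is a record.\<close>

lemma V_seq_eq_root_points:
  "set (V_seq m T) = root_points m T" "v_stat m T = card (root_points m T)"
proof -
  let ?r = "2 * m + 1"
  have "set (V_seq m T) = root_points m T \<and> v_stat m T = card (root_points m T)"
  proof (cases "row_empty T ?r")
    case True
    \<comment> \<open>An empty top row is itself a row with root \<open>2m + 1\<close>, and distinct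
      unoccupied rows have distinct roots.\<close>
    have "root_row m T (j, i) \<noteq> ?r" if p: "(j, i) \<in> T" for j i
    proof
      assume r: "root_row m T (j, i) = ?r"
      have j: "1 \<le> j" "j \<le> Suc m"
        using point_range[OF T order_refl p] by auto
      have "root_row m T (j, ?r) = ?r"
        using root_row_slot[OF T order_refl j, of ?r] by simp
      moreover have "?r \<in> {1..2 * m + 1} - occupied T j"
        using True by (auto simp: occupied_def row_empty_def)
      ultimately have "i = ?r"
        using bij_betw_root_row[OF T order_refl j] point_not_occupied[OF T order_refl p] r
        by (metis (no_types, lifting) bij_betw_imp_inj_on inj_onD)
      with p True show False by (auto simp: row_empty_def)
    qed
    then have "root_points m T = {}"
      by (auto simp: root_points_def)
    with True show ?thesis
      by (simp add: V_seq_def S_seq_def v_stat_def)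
  next
    case False
    define p where "p = row_point T ?r"
    define P where "P = point_path m T p"
    have P_0: "P 0 = p" and P_Suc: "P (Suc k) = path_step m T (P k)" for k
      by (simp_all add: P_def point_path_def)
    have c: "path_col m T p = (\<lambda>k. fst (P k))"
      by (simp add: path_col_def P_def fun_eq_iff)
    have P_in: "P k \<in> T" for k
    proof (induction k)
      case 0
      then show ?case using row_point(1)[OF False] by (simp add: P_0 p_def)
    next
      case (Suc k)
      then show ?case using row_point(1) by (simp add: P_Suc path_step_def)
    qed
    have fin: "finite (range (\<lambda>k. fst (P k)))"
      by (rule finite_subset [of _ "fst ` T"]) (use P_in finite_placement[OF T order_refl] in auto)
    have root_back: "root_step m T j (snd (P (Suc k))) = snd (P k)"
      if j: "fst (P k) < j" "j \<le> m" and ne: "P (Suc k) \<noteq> P k" for j k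
    proof -
      obtain d i where di: "P k = (d, i)" by force
      have d: "d \<in> {1..m}" "i = lower_row T d \<or> i = upper_row T d"
        using P_in[of k] point_range[OF T order_refl, of d i] in_column[OF T order_refl, of d i]
        unfolding di by simp_all
      have "\<not> row_empty T (path_target m T (P k))" "P (Suc k) = row_point T (path_target m T (P k))"
        using ne unfolding P_Suc path_step_def by (simp_all split: if_splits)
      then have s: "snd (P (Suc k)) = (if i = upper_row T d then 2 * m + 1 - d else d)"
        using row_point(2) di by (simp add: path_target_def)
      show ?thesis
      proof (cases "i = upper_row T d")
        case True
        with s show ?thesis
          using d(1) j di root_step_high[of d j m T] by simp
      next
        case False
        with s show ?thesis
          using d j di root_step_low[of d j m T] by simp
      qed
    qed
    have stable: "P k = P n" if "P (Suc n) = P n" "n \<le> k" for n k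
      using that(2)
    proof (induction k rule: dec_induct)
      case (step k)
      then show ?case using that(1) by (simp add: P_Suc)
    qed simp
    have record_root: "root_row m T (P k) = ?r" if rec: "is_record (\<lambda>k. fst (P k)) k" for k
    proof -
      obtain j i where ji: "P k = (j, i)" by force
      have j: "j \<in> {1..m}"
        using P_in[of k] point_range[OF T order_refl] ji by auto
      have "(root_step m T j ^^ n) (snd (P n)) = ?r" if "n \<le> k" for n
        using that
      proof (induction n)
        case 0
        then show ?case using row_point(2)[OF False] by (simp add: P_0 p_def)
      next
        case (Suc n)
        have "fst (P n) < j"
          using rec Suc.prems ji by (auto simp: is_record_def)
        \<comment> \<open>A path that stalled here would remain in a column below \<open>j\<close>
          and never reach the record.\<close>
        moreover from this have "P (Suc n) \<noteq> P n"
          using stable[of n k] Suc.prems ji by (metis Suc_leD fst_conv less_irrefl)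
        ultimately have "root_step m T j (snd (P (Suc n))) = snd (P n)"
          using root_back[of n j] j by simp
        with Suc show ?case
          by (simp add: funpow_Suc_right del: funpow.simps)
      qed
      from this[of k] have "(root_step m T j ^^ k) i = ?r"
        using ji by simp
      then show ?thesis
        using limit_point_eq[of "root_step m T j" k i] ji
        by (simp add: root_row_eq root_step_def)
    qed
    have root_record: "\<exists>N. is_record (\<lambda>k. fst (P k)) N \<and> P N = (j, i)"
      if ji: "(j, i) \<in> T" and root: "root_row m T (j, i) = ?r" for j i
    proof -
      let ?f = "root_step m T j"
      have j: "1 \<le> j" "j \<le> m"
        using point_range[OF T order_refl ji] by auto
      interpret partial_injection ?f "{1..2 * m + 1}" "labels m j"
        using j by (intro partial_injection[OF T order_refl]) auto
      have image: "?f ` labels m j = occupied T j"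
        using root_step_labels[OF T order_refl] j by simp
      have "i \<in> {1..2 * m + 1} - ?f ` labels m j"
        using point_not_occupied[OF T order_refl ji] image by simp
      then obtain N where N: "limit_point ?f i = (?f ^^ N) i" "\<forall>n<N. (?f ^^ n) i \<in> labels m j"
        by (rule limit_point_exits)
      have N_root: "(?f ^^ N) i = ?r"
        using N(1) root by (simp add: root_row_eq)
      \<comment> \<open>Row \<open>r\<close> is a label; the column \<open>e\<close> owning it is
        below \<open>j\<close>, and the point of \<open>e\<close> in row \<open>?f r\<close> has
        path target \<open>r\<close>. Hence the path follows the root iteration in reverse.\<close>
      have pred: "fst (P d) < j \<and> P (Suc d) = row_point T ((?f ^^ (N - Suc d)) i)"
        if d: "d < N" "P d = row_point T ((?f ^^ (N - d)) i)" for d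
      proof -
        define r where "r = (?f ^^ (N - Suc d)) i"
        have r: "r \<in> labels m j"
          using N(2) d by (simp add: r_def)
        have "N - d = Suc (N - Suc d)"
          using d by simp
        then have f_r: "(?f ^^ (N - d)) i = ?f r"
          by (simp add: r_def)
        obtain e where e: "e \<in> {1..m}" "e < j" "(e, ?f r) \<in> T"
          and r_eq: "r = (if ?f r = upper_row T e then 2 * m + 1 - e else e)"
        proof -
          have jm: "j \<le> Suc m" using j by simp
          from r jm show thesis
          proof (cases rule: labels_cases)
            case (1 e)
            then have "e \<in> {1..m}" "?f r = lower_row T e"
              using j root_step_low[of e j m T] by auto
            with 1 that[of e] lower_less_upper[OF T order_refl] in_column[OF T order_refl]
                show thesis
              by fastforce
          next
            case (2 e)
            then have "e \<in> {1..m}" "?f r = upper_row T e"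
              using j root_step_high[of e j m T] by auto
            with 2 that[of e] in_column[OF T order_refl] show thesis
              by fastforce
          qed
        qed
        have P_d: "P d = (e, ?f r)"
          using d(2) f_r row_point_eq[OF e(3)] by simp
        \<comment> \<open>Row \<open>r\<close> is either the starting row \<open>i\<close>, which
          contains a point of \<open>T\<close>, or a value of the root step on a label, hence
          occupied.\<close>
        have "\<not> row_empty T r"
        proof (cases "N - Suc d")
          case 0
          then show ?thesis using ji by (auto simp: r_def row_empty_def)
        next
          case (Suc n)
          then have "r \<in> occupied T j"
            using image N(2) d by (auto simp: r_def)
          then show ?thesis by (auto simp: occupied_def row_empty_def)
        qed
        moreover have "path_target m T (P d) = r"
          using P_d r_eq by (simp add: path_target_def)
        ultimately show ?thesis
          using P_d e j by (simp add: P_Suc path_step_def r_def)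
      qed
      have P_d: "P d = row_point T ((?f ^^ (N - d)) i)" if "d \<le> N" for d
        using that
      proof (induction d)
        case 0
        then show ?case using N_root by (simp add: P_0 p_def)
      next
        case (Suc d)
        then show ?case using pred[of d] by simp
      qed
      have "P N = (j, i)"
        using P_d[of N] row_point_eq[OF ji] by simp
      moreover have "is_record (\<lambda>k. fst (P k)) N"
        using \<open>P N = (j, i)\<close> pred P_d by (auto simp: is_record_def)
      ultimately show ?thesis by blast
    qed
    let ?R = "{k. is_record (\<lambda>k. fst (P k)) k}"
    have "bij_betw P ?R (root_points m T)"
    proof (rule bij_betw_imageI)
      show "inj_on P ?R"
        by (rule linorder_inj_onI) (auto simp: is_record_def)
      show "P ` ?R = root_points m T"
        using record_root root_record P_in by (force simp: root_points_def)
    qed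
    moreover have "bij_betw (record_index m T p) {..last_record m T p} ?R"
      using record_index_bij_betw[of m T p] fin unfolding c by blast
    ultimately have bij: "bij_betw (P \<circ> record_index m T p) {..last_record m T p} (root_points m T)"
      by (rule bij_betw_trans [rotated])
    have V: "V_seq m T = map (P \<circ> record_index m T p) [0..<Suc (last_record m T p)]"
      using False by (simp add: V_seq_def S_seq_def P_def p_def Let_def o_def)
    have "set (V_seq m T) = root_points m T"
      using bij unfolding V by (simp only: set_map set_upt atLeast0LessThan lessThan_Suc_atMost
          bij_betw_def)
    moreover have "card (root_points m T) = v_stat m T"
      using bij_betw_same_card[OF bij] by (simp add: v_stat_def V)
    ultimately show ?thesis by simp
  qed
  then show "set (V_seq m T) = root_points m T" "v_stat m T = card (root_points m T)"
    by simp_all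
qed

end

subsection \<open>Summation over placements\<close>

text \<open>The condition for \<open>G_set\<close> with \<open>V(T)\<close> replaced by its
  description through roots. In this form it involves only column \<open>j\<close> and the columns
  before it, whereas the path runs through the whole placement.\<close>

definition in_G :: "nat \<Rightarrow> point set \<Rightarrow> point \<Rightarrow> bool" where
  "in_G m T = (\<lambda>(j, i). 2 * m + 2 - j \<le> i \<and> root_row m T (j, i) = j \<and>
     (\<exists>i'. i' \<noteq> i \<and> (j, i') \<in> T \<and> root_row m T (j, i') = 2 * m + 1))"

text \<open>For a point of \<open>G_set\<close> the factor \<open>px + 1\<close> replaces the factor
  2 of a free point, which accounts for the exponent
  \<open>fr_stat m T - g_stat m T\<close>.\<close>

definition point_wt :: "nat \<Rightarrow> point set \<Rightarrow> point \<Rightarrow> rat poly" where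
  "point_wt m T p =
     (if in_G m T p then px + 1 else if 2 * m + 2 - fst p \<le> snd p then 2 else 1) *
     (if root_row m T p = 2 * m + 1 then px else 1)"

lemma statistics_weight:
  assumes T: "T \<in> placements m"
  shows "2 ^ (fr_stat m T - g_stat m T) * [:0, 1:] ^ v_stat m T * [:1, 1:] ^ g_stat m T
    = prod (point_wt m T) T"
proof -
  have T': "T \<in> partial_placements m m"
    using T by (simp add: placements_eq)
  have fin: "finite T"
    using T' by (rule finite_placement) simp
  let ?F = "free_points m T" and ?G = "G_set m T" and ?V = "root_points m T"
  have G: "?G = {p \<in> T. in_G m T p}"
    unfolding G_set_def V_seq_eq_root_points[OF T']
    by (auto simp: free_points_def in_G_def root_points_def)
  have F: "?F = {p \<in> T. 2 * m + 2 - fst p \<le> snd p}"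
    by (auto simp: free_points_def)
  have "?G \<subseteq> ?F"
    by (auto simp: G_set_def)
  moreover have "finite ?F"
    using fin by (simp add: F)
  ultimately have card: "fr_stat m T - g_stat m T = card (?F - ?G)"
    by (simp add: fr_stat_def g_stat_def card_Diff_subset finite_subset)
  have 1: "(\<Prod>p\<in>T. if p \<in> B then c else 1) = c ^ card B" if "B \<subseteq> T" for B and c :: "rat poly"
    using fin that by (simp add: prod.If_cases Int_absorb1 Collect_mem_eq)
  have "point_wt m T p = (if p \<in> ?F - ?G then 2 else 1) * (if p \<in> ?V then px else 1) *
      (if p \<in> ?G then px + 1 else 1)" if "p \<in> T" for p
    using that \<open>?G \<subseteq> ?F\<close> by (auto simp: point_wt_def G F root_points_def in_G_def)
  then have "prod (point_wt m T) T = (\<Prod>p\<in>T. (if p \<in> ?F - ?G then 2 else 1) *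
      (if p \<in> ?V then px else 1) * (if p \<in> ?G then px + 1 else 1))"
    by (rule prod.cong [OF refl])
  also have "\<dots> = 2 ^ card (?F - ?G) * px ^ card ?V * (px + 1) ^ card ?G"
  proof -
    have "?F - ?G \<subseteq> T" "?V \<subseteq> T" "?G \<subseteq> T"
      by (auto simp: F G root_points_def)
    then show ?thesis
      by (simp only: prod.distrib 1)
  qed
  finally have "prod (point_wt m T) T = 2 ^ card (?F - ?G) * px ^ card ?V * (px + 1) ^ card ?G" .
  moreover have "px + 1 = [:1, 1:]"
    by (simp add: px_def one_pCons)
  ultimately show ?thesis
    unfolding card unfolding V_seq_eq_root_points[OF T'] g_stat_def by (simp add: px_def)
qed

section \<open>Building placements column by column\<close>

definition add_column :: "nat \<Rightarrow> point set \<Rightarrow> nat set \<Rightarrow> point set" where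
  "add_column j T C = T \<union> {j} \<times> C"

definition column_choices :: "nat \<Rightarrow> nat \<Rightarrow> point set \<Rightarrow> nat set set" where
  "column_choices m j T = {C \<in> pairs ({1..2 * m + 1} - snd ` T). j \<in> snd ` T \<union> C}"

lemma bij_betw_add_column:
  assumes k: "k < m"
  shows "bij_betw (\<lambda>(T, C). add_column (Suc k) T C)
    (SIGMA T:partial_placements m k. column_choices m (Suc k) T) (partial_placements m (Suc k))"
proof (rule bij_betw_byWitness [where f' = "\<lambda>T. (T \<inter> {1..k} \<times> UNIV, {i. (Suc k, i) \<in> T})"];
    (intro ballI image_subsetI)?)
  fix x assume "x \<in> (SIGMA T:partial_placements m k. column_choices m (Suc k) T)"
  then obtain T C where x: "x = (T, C)" and T: "T \<in> partial_placements m k"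
    and C: "C \<subseteq> {1..2 * m + 1} - snd ` T" "card C = 2" "Suc k \<in> snd ` T \<union> C"
    by (auto simp: column_choices_def pairs_def)
  have T_sub: "T \<subseteq> {1..k} \<times> {1..2 * m + 1}" and T_col: "\<And>j. j \<in> {1..k} \<Longrightarrow> card {i. (j, i) \<in> T} = 2"
    and T_inj: "inj_on snd T" and T_rows: "{1..k} \<subseteq> snd ` T" and T_le: "\<forall>(j, i)\<in>T. j \<le> i"
    using T by (simp_all add: partial_placements_def)
  show "(case case x of (T, C) \<Rightarrow> add_column (Suc k) T C of T \<Rightarrow>
      (T \<inter> {1..k} \<times> UNIV, {i. (Suc k, i) \<in> T})) = x"
    using T_sub by (auto simp: x add_column_def)
  let ?T = "T \<union> {Suc k} \<times> C"
  have "{i. (j, i) \<in> ?T} = (if j = Suc k then C else {i. (j, i) \<in> T})" for j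
    using T_sub by auto
  then have "\<forall>j\<in>{1..Suc k}. card {i. (j, i) \<in> ?T} = 2"
    using T_col C(2) by simp
  moreover have "inj_on snd ?T"
  proof -
    have "i \<notin> C" if "(j, i) \<in> T" for j i
      using that C(1) by force
    then show ?thesis
      using T_inj by (auto simp: inj_on_def)
  qed
  moreover have "{1..Suc k} \<subseteq> snd ` ?T"
  proof
    fix i assume "i \<in> {1..Suc k}"
    then have "i \<in> {1..k} \<or> i = Suc k" by auto
    moreover have "snd ` ?T = snd ` T \<union> C" by force
    ultimately show "i \<in> snd ` ?T"
      using T_rows C(3) by blast
  qed
  \<comment> \<open>The triangular condition on the new column is automatic, since rows
    \<open>1, ..., k\<close> are already used.\<close>
  moreover have "Suc k \<le> i" if "i \<in> C" for i
  proof (rule ccontr)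
    assume "\<not> Suc k \<le> i"
    with that C(1) have "i \<in> {1..k}" by auto
    with T_rows that C(1) show False by blast
  qed
  then have "\<forall>(j, i)\<in>?T. j \<le> i"
    using T_le by auto
  moreover have "?T \<subseteq> {1..Suc k} \<times> {1..2 * m + 1}"
    using T_sub C(1) by auto
  ultimately show "(case x of (T, C) \<Rightarrow> add_column (Suc k) T C) \<in> partial_placements m (Suc k)"
    by (simp add: x add_column_def partial_placements_def del: atLeastAtMost_iff)
next
  fix T assume T: "T \<in> partial_placements m (Suc k)"
  have T_sub: "T \<subseteq> {1..Suc k} \<times> {1..2 * m + 1}"
    and T_col: "\<And>j. j \<in> {1..Suc k} \<Longrightarrow> card {i. (j, i) \<in> T} = 2"
    and T_inj: "inj_on snd T" and T_rows: "{1..Suc k} \<subseteq> snd ` T" and T_le: "\<forall>(j, i)\<in>T. j \<le> i"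
    using T by (simp_all add: partial_placements_def)
  let ?T = "T \<inter> {1..k} \<times> UNIV" and ?C = "{i. (Suc k, i) \<in> T}"
  have decomp: "T = ?T \<union> {Suc k} \<times> ?C"
  proof -
    have "p \<in> ?T \<union> {Suc k} \<times> ?C" if p: "p \<in> T" for p
    proof -
      have "fst p \<in> {1..Suc k}" using p T_sub by auto
      then have "fst p \<in> {1..k} \<or> fst p = Suc k" by auto
      with p show ?thesis by (cases p) auto
    qed
    then have "T \<subseteq> ?T \<union> {Suc k} \<times> ?C" by (rule subsetI)
    moreover have "?T \<union> {Suc k} \<times> ?C \<subseteq> T" by auto
    ultimately show ?thesis by (rule equalityI)
  qed
  then show "(case (?T, ?C) of (T, C) \<Rightarrow> add_column (Suc k) T C) = T"
    by (simp add: add_column_def)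
  have "card {i. (j, i) \<in> ?T} = 2" if "j \<in> {1..k}" for j
    using T_col[of j] that by simp
  \<comment> \<open>A point in a row \<open>i \<le> k\<close> lies in a column at most
    \<open>i\<close>, so it survives the removal of column \<open>Suc k\<close>.\<close>
  moreover have "{1..k} \<subseteq> snd ` ?T"
  proof
    fix i assume i: "i \<in> {1..k}"
    with T_rows obtain j where j: "(j, i) \<in> T" by fastforce
    with T_le T_sub i have "j \<in> {1..k}" by fastforce
    with j show "i \<in> snd ` ?T" by force
  qed
  ultimately have "?T \<in> partial_placements m k"
    using T_sub T_inj T_le by (auto simp: partial_placements_def intro: inj_on_subset)
  moreover have "?C \<subseteq> {1..2 * m + 1} - snd ` ?T"
  proof
    fix i assume i: "i \<in> ?C"
    then have "i \<in> {1..2 * m + 1}" using T_sub by auto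
    moreover have "i \<notin> snd ` ?T"
    proof
      assume "i \<in> snd ` ?T"
      then obtain j where "(j, i) \<in> T" "j \<le> k" by auto
      with i inj_onD[OF T_inj, of "(j, i)" "(Suc k, i)"] show False by simp
    qed
    ultimately show "i \<in> {1..2 * m + 1} - snd ` ?T" by blast
  qed
  moreover have "Suc k \<in> snd ` ?T \<union> ?C"
  proof -
    have "Suc k \<in> snd ` T" using T_rows by auto
    then obtain j where j: "(j, Suc k) \<in> T" by auto
    then have "j \<in> {1..k} \<or> j = Suc k" using T_sub by auto
    with j show ?thesis by force
  qed
  ultimately show "(?T, ?C) \<in> (SIGMA T:partial_placements m k. column_choices m (Suc k) T)"
    using T_col[of "Suc k"] by (simp add: column_choices_def pairs_def)
qed

lemma finite_partial_placements: "finite (partial_placements m k)"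
  by (rule finite_subset [of _ "Pow ({1..k} \<times> {1..2 * m + 1})"])
    (auto simp: partial_placements_def)

text \<open>Roots of points in column \<open>j\<close> are computed from the columns before
  \<open>j\<close> alone.\<close>

lemma root_row_add_column:
  assumes "j \<le> Suc k" "k < m"
  shows "root_row m (add_column (Suc k) T C) (j, i) = root_row m T (j, i)"
proof -
  have col: "{i. (c, i) \<in> add_column (Suc k) T C} = {i. (c, i) \<in> T}" if "c \<noteq> Suc k" for c
    using that by (auto simp: add_column_def)
  have "root_step m (add_column (Suc k) T C) j = root_step m T j"
    using assms col by (auto simp: root_step_def upper_row_def lower_row_def fun_eq_iff)
  then show ?thesis
    by (simp add: root_row_eq)
qed

lemma root_row_next_column:
  assumes T: "T \<in> partial_placements m k" and k: "k < m"
  shows "bij_betw (\<lambda>i. root_row m T (Suc k, i)) ({1..2 * m + 1} - snd ` T)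
      (insert (2 * m + 1) (slots m (m - k)))"
    and "s \<in> insert (2 * m + 1) (slots m (m - k)) \<Longrightarrow> root_row m T (Suc k, s) = s"
proof -
  have "c < Suc k" if "(c, i) \<in> T" for c i
    using point_range[OF T, of c i] that k by simp
  then have "occupied T (Suc k) = snd ` T"
    by (force simp: occupied_def)
  then show "bij_betw (\<lambda>i. root_row m T (Suc k, i)) ({1..2 * m + 1} - snd ` T)
      (insert (2 * m + 1) (slots m (m - k)))"
    using bij_betw_root_row[OF T, of "Suc k"] k by simp
  show "s \<in> insert (2 * m + 1) (slots m (m - k)) \<Longrightarrow> root_row m T (Suc k, s) = s"
    using root_row_slot[OF T, of "Suc k"] k by simp
qed

lemma column_weight:
  assumes T: "T \<in> partial_placements m k" and k: "k < m"
    and C: "C \<in> pairs ({1..2 * m + 1} - snd ` T)"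
  defines "r \<equiv> \<lambda>i. root_row m T (Suc k, i)"
  shows "(\<Prod>i\<in>C. point_wt m (add_column (Suc k) T C) (Suc k, i))
      = (\<Prod>s\<in>r ` C. pick_wt m (Suc k) (snd ` T) (r ` C) s)"
    and "Suc k \<in> snd ` T \<union> C \<longleftrightarrow> Suc k \<in> snd ` T \<union> r ` C"
    and "(snd ` T \<union> C) \<inter> slots m (m - k) = (snd ` T \<union> r ` C) \<inter> slots m (m - k)"
proof -
  let ?D = "snd ` T" and ?T = "add_column (Suc k) T C"
      and ?S = "insert (2 * m + 1) (slots m (m - k))"
  let ?U = "{1..2 * m + 1} - ?D"
  have bij: "bij_betw r ?U ?S"
    unfolding r_def by (rule root_row_next_column(1) [OF T k])
  have r_slot: "r s = s" if "s \<in> ?S" for s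
    unfolding r_def using that by (rule root_row_next_column(2) [OF T k])
  have C_sub: "C \<subseteq> ?U"
    using C by (simp add: pairs_def)
  have inj: "inj_on r ?U"
    using bij by (rule bij_betw_imp_inj_on)
  have S_U: "s \<in> {1..2 * m + 1}" if "s \<in> ?S" for s
    using that by (auto simp: slots_def)
  have r_eq: "r i = s \<longleftrightarrow> i = s" if "i \<in> ?U" "s \<in> ?S" "s \<notin> ?D" for i s
    using inj_onD[OF inj, of i s] r_slot[OF that(2)] that S_U by auto
  have r_in: "r i \<in> ?S" if "i \<in> ?U" for i
    using bij_betw_apply[OF bij that] .
  have clean: "s \<in> r ` C \<longleftrightarrow> s \<in> C" if "s \<in> ?S" "s \<notin> ?D" for s
  proof -
    have "r i = s \<longleftrightarrow> i = s" if "i \<in> C" for i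
      using r_eq[of i s] that \<open>s \<in> ?S\<close> \<open>s \<notin> ?D\<close> C_sub by blast
    then show ?thesis
      unfolding image_iff by metis
  qed
  show "Suc k \<in> ?D \<union> C \<longleftrightarrow> Suc k \<in> ?D \<union> r ` C"
  proof -
    have "Suc k \<in> ?S" using k by (simp add: slots_def)
    with clean[of "Suc k"] show ?thesis by (metis UnCI UnE)
  qed
  show "(?D \<union> C) \<inter> slots m (m - k) = (?D \<union> r ` C) \<inter> slots m (m - k)"
  proof -
    have "s \<in> ?D \<union> C \<longleftrightarrow> s \<in> ?D \<union> r ` C" if "s \<in> slots m (m - k)" for s
      using clean[of s] that by (metis UnCI UnE insertI2)
    then have "s \<in> (?D \<union> C) \<inter> slots m (m - k) \<longleftrightarrow> s \<in> (?D \<union> r ` C) \<inter> slots m (m - k)" for s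
      by (cases "s \<in> slots m (m - k)") (simp_all only: Int_iff simp_thms)
    then show ?thesis
      by (rule set_eqI)
  qed
  have rows: "{1..k} \<subseteq> ?D"
    using T by (simp add: partial_placements_def)
  have free: "2 * m + 2 - Suc k \<le> i \<longleftrightarrow> r i = 2 * m + 1 \<or> r i \<in> ?D" if "i \<in> C" for i
  proof -
    have i: "i \<in> ?U" using that C_sub by blast
    then have "i \<notin> {1..k}" "i \<in> {1..2 * m + 1}"
      using rows by blast+
    then have "i > k" "i \<le> 2 * m + 1"
      by simp_all
    show ?thesis
    proof (cases "i \<in> ?S")
      case True
      then show ?thesis
        using r_slot[OF True] i k by (auto simp: slots_def)
    next
      case False
      then have "r i \<noteq> i" using r_in[OF i] by auto
      then have "r i \<in> ?D" using r_eq[OF i r_in[OF i]] by metis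
      moreover have "2 * m + 2 - Suc k \<le> i"
        using False \<open>i > k\<close> \<open>i \<le> 2 * m + 1\<close> k by (auto simp: slots_def)
      ultimately show ?thesis by simp
    qed
  qed
  have root: "root_row m ?T (Suc k, i) = r i" for i
    using root_row_add_column[of "Suc k" k m T C i] k by (simp add: r_def)
  have in_T: "(Suc k, i) \<in> ?T \<longleftrightarrow> i \<in> C" for i
    using point_range[OF T, of "Suc k" i] k by (auto simp: add_column_def)
  have "point_wt m ?T (Suc k, i) = pick_wt m (Suc k) ?D (r ` C) (r i)" if i: "i \<in> C" for i
  proof -
    have ne: "Suc k \<noteq> 2 * m + 1" using k by simp
    \<comment> \<open>A row with root \<open>2m + 1\<close> is automatically different from a row
      with root \<open>Suc k\<close>.\<close>
    then have "(\<exists>i'. i' \<noteq> i \<and> i' \<in> C \<and> r i' = 2 * m + 1) \<longleftrightarrow> 2 * m + 1 \<in> r ` C"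
      if "r i = Suc k"
      using that unfolding image_iff by metis
    then have in_G: "in_G m ?T (Suc k, i) \<longleftrightarrow> r i = Suc k \<and> r i \<in> ?D \<and> 2 * m + 1 \<in> r ` C"
      using free[OF i] ne unfolding in_G_def prod.case root in_T by metis
    show ?thesis
      using free[OF i] k unfolding point_wt_def pick_wt_def in_G root fst_conv snd_conv
      by auto
  qed
  moreover have "inj_on r C"
    using inj C_sub by (rule inj_on_subset)
  ultimately show "(\<Prod>i\<in>C. point_wt m ?T (Suc k, i))
      = (\<Prod>s\<in>r ` C. pick_wt m (Suc k) ?D (r ` C) s)"
    by (simp add: prod.reindex)
qed

section \<open>Telescoping over the number of columns\<close>

lemma Int_eq_subset: "\<lbrakk>X \<inter> S = Y \<inter> S; S' \<subseteq> S\<rbrakk> \<Longrightarrow> X \<inter> S' = Y \<inter> S'"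
  by blast

lemma pick_sum_cong:
  assumes "D \<inter> slots m M = D' \<inter> slots m M" "M \<le> m"
  shows "pick_sum m M D = pick_sum m M D'"
  using assms
proof (induction M arbitrary: D D')
  case (Suc M)
  have M: "M < m" using Suc.prems by simp
  have "D \<inter> slots m M = D' \<inter> slots m M"
    using Suc.prems by (auto simp: slots_Suc set_eq_iff)
  then have "pick_sum m M (D \<union> A) = pick_sum m M (D' \<union> A)" for A
    using M by (intro Suc.IH) auto
  moreover have "step_wt m (m - M) D A = step_wt m (m - M) D' A"
    if A: "A \<in> pairs (insert (2 * m + 1) (slots m (Suc M)))" for A
  proof -
    have D: "s \<in> D \<longleftrightarrow> s \<in> D'" if "s \<in> slots m (Suc M)" for s
      using Suc.prems(1) that by blast
    have "pick_wt m (m - M) D A s = pick_wt m (m - M) D' A s" if "s \<in> A" for s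
      using A that D[of s] by (auto simp: pick_wt_def pairs_def)
    then show ?thesis
      using D[of "m - M"] M by (simp add: step_wt_def slots_Suc)
  qed
  ultimately show ?case
    by (auto intro: sum.cong)
qed simp

text \<open>The summand is the weight of the columns already placed times the total weight of all
  continuations, expressed through slots. Trading the sum over the choices for column
  \<open>Suc k\<close> for one step of \<open>pick_sum\<close> leaves the total unchanged.\<close>

lemma sum_partial_placements_Suc:
  assumes k: "k < m"
  shows "(\<Sum>T\<in>partial_placements m (Suc k). prod (point_wt m T) T * pick_sum m (m - Suc k) (snd ` T))
    = (\<Sum>T\<in>partial_placements m k. prod (point_wt m T) T * pick_sum m (m - k) (snd ` T))"
proof -
  let ?P = "partial_placements m" and ?M = "m - Suc k"
  let ?h = "\<lambda>T. prod (point_wt m T) T * pick_sum m ?M (snd ` T)"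
  have "sum ?h (?P (Suc k))
      = (\<Sum>(T, C)\<in>(SIGMA T:?P k. column_choices m (Suc k) T). ?h (add_column (Suc k) T C))"
    unfolding sum.reindex_bij_betw [OF bij_betw_add_column [OF k], of ?h, symmetric]
    by (rule sum.cong [OF refl]) (simp only: case_prod_unfold)
  also have "\<dots> = (\<Sum>T\<in>?P k. \<Sum>C\<in>column_choices m (Suc k) T. ?h (add_column (Suc k) T C))"
    by (rule sum.Sigma [symmetric]) (auto simp: finite_partial_placements column_choices_def)
  also have "\<dots> = (\<Sum>T\<in>?P k. prod (point_wt m T) T * pick_sum m (m - k) (snd ` T))"
  proof (rule sum.cong [OF refl])
    fix T assume T: "T \<in> ?P k"
    let ?D = "snd ` T" and ?U = "{1..2 * m + 1} - snd ` T"
        and ?S = "insert (2 * m + 1) (slots m (m - k))"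
    let ?r = "\<lambda>i. root_row m T (Suc k, i)"
    let ?g = "\<lambda>A. step_wt m (Suc k) ?D A * pick_sum m ?M (?D \<union> A)"
    have "?h (add_column (Suc k) T C) = prod (point_wt m T) T * ?g (?r ` C)"
      if C: "C \<in> column_choices m (Suc k) T" for C
    proof -
      let ?T = "add_column (Suc k) T C"
      have C': "C \<in> pairs ?U" "Suc k \<in> ?D \<union> C"
        using C by (simp_all add: column_choices_def)
      have "C \<subseteq> {1..2 * m + 1}"
        using C'(1) by (auto simp: pairs_def)
      then have fin: "finite C"
        by (rule finite_subset) simp
      have "(Suc k, i) \<notin> T" for i
        using point_range[OF T, of "Suc k" i] k by auto
      then have disj: "T \<inter> {Suc k} \<times> C = {}"
        by auto
      have "prod (point_wt m ?T) ?T = prod (point_wt m ?T) T * prod (point_wt m ?T) ({Suc k} \<times> C)"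
        unfolding add_column_def using disj fin finite_placement[OF T] k
        by (intro prod.union_disjoint) auto
      also have "prod (point_wt m ?T) ({Suc k} \<times> C) = (\<Prod>i\<in>C. point_wt m ?T (Suc k, i))"
      proof -
        have "{Suc k} \<times> C = Pair (Suc k) ` C" by auto
        then show ?thesis by (simp add: prod.reindex inj_on_def)
      qed
      also have "\<dots> = (\<Prod>s\<in>?r ` C. pick_wt m (Suc k) ?D (?r ` C) s)"
        by (rule column_weight(1)[OF T k C'(1)])
      also have "prod (point_wt m ?T) T = prod (point_wt m T) T"
      proof (rule prod.cong [OF refl])
        fix p assume "p \<in> T"
        then obtain j i where p: "p = (j, i)" "(j, i) \<in> T"
          by (cases p) simp
        then have j: "j \<le> k"
          using point_range[OF T, of j i] k by simp
        then have "(j, i') \<in> ?T \<longleftrightarrow> (j, i') \<in> T" for i'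
          using p by (auto simp: add_column_def)
        then show "point_wt m ?T p = point_wt m T p"
          using p j root_row_add_column[of j k m T C] k by (simp add: point_wt_def in_G_def)
      qed
      also have "(\<Prod>s\<in>?r ` C. pick_wt m (Suc k) ?D (?r ` C) s) = step_wt m (Suc k) ?D (?r ` C)"
        using column_weight(2)[OF T k C'(1)] C'(2) by (simp add: step_wt_def)
      finally have "prod (point_wt m ?T) ?T
          = prod (point_wt m T) T * step_wt m (Suc k) ?D (?r ` C)" .
      \<comment> \<open>The used rows after column \<open>Suc k\<close> and the state reached by
        picking roots agree on the remaining slots, and \<open>pick_sum\<close> sees nothing
        else.\<close>
      moreover have "pick_sum m ?M (snd ` ?T) = pick_sum m ?M (?D \<union> ?r ` C)"
      proof (rule pick_sum_cong)
        have "snd ` ?T = ?D \<union> C"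
          by (force simp: add_column_def)
        moreover have "(?D \<union> C) \<inter> slots m ?M = (?D \<union> ?r ` C) \<inter> slots m ?M"
          using column_weight(3)[OF T k C'(1)]
          by (rule Int_eq_subset) (auto simp: slots_def)
        ultimately show "snd ` ?T \<inter> slots m ?M = (?D \<union> ?r ` C) \<inter> slots m ?M"
          by simp
      qed simp
      ultimately show ?thesis by (simp add: mult.assoc)
    qed
    then have "(\<Sum>C\<in>column_choices m (Suc k) T. ?h (add_column (Suc k) T C))
        = (\<Sum>C\<in>column_choices m (Suc k) T. prod (point_wt m T) T * ?g (?r ` C))"
      by (rule sum.cong [OF refl])
    also have "\<dots> = prod (point_wt m T) T * (\<Sum>C\<in>column_choices m (Suc k) T. ?g (?r ` C))"
      by (simp add: sum_distrib_left)
    \<comment> \<open>The added choices leave row \<open>Suc k\<close> empty, where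
      \<open>step_wt\<close> vanishes.\<close>
    also have "(\<Sum>C\<in>column_choices m (Suc k) T. ?g (?r ` C)) = (\<Sum>C\<in>pairs ?U. ?g (?r ` C))"
    proof (rule sum.mono_neutral_left)
      show "\<forall>C\<in>pairs ?U - column_choices m (Suc k) T. ?g (?r ` C) = 0"
        using column_weight(2)[OF T k] by (auto simp: column_choices_def step_wt_def)
    qed (auto simp: column_choices_def)
    also have "\<dots> = sum ?g (pairs ?S)"
      by (rule sum.reindex_bij_betw [OF bij_betw_pairs [OF root_row_next_column(1)[OF T k]]])
    also have "\<dots> = pick_sum m (m - k) ?D"
    proof -
      have "m - k = Suc ?M" "m - ?M = Suc k"
        using k by simp_all
      then show ?thesis
        using pick_sum.simps(2)[of m ?M ?D] by simp
    qed
    finally show "(\<Sum>C\<in>column_choices m (Suc k) T. ?h (add_column (Suc k) T C))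
        = prod (point_wt m T) T * pick_sum m (m - k) ?D" .
  qed
  finally show ?thesis .
qed

text \<open>The total is the same for every \<open>k\<close>: at \<open>k = 0\<close> it is
  \<open>pick_sum_empty\<close>, and at \<open>k = m\<close> the remaining \<open>pick_sum\<close>
  equals 1.\<close>

lemma sum_placements: "(\<Sum>T\<in>placements m. prod (point_wt m T) T) = Pn (Suc m)"
proof -
  have "(\<Sum>T\<in>partial_placements m k. prod (point_wt m T) T * pick_sum m (m - k) (snd ` T))
      = Pn (Suc m)"
    if "k \<le> m" for k
    using that
  proof (induction k)
    case 0
    have "partial_placements m 0 = {{}}"
      by (auto simp: partial_placements_def)
    then show ?case by (simp add: pick_sum_empty)
  next
    case (Suc k)
    then show ?case by (simp add: sum_partial_placements_Suc)
  qed
  from this[of m] show ?thesis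
    by (simp add: placements_eq)
qed

theorem theorem2:
  fixes n :: nat
  assumes "n \<ge> 2"
  shows "Pn n = (\<Sum>T\<in>placements (n - 1).
           2 ^ (fr_stat (n - 1) T - g_stat (n - 1) T) * [:0, 1:] ^ v_stat (n - 1) T * [:1, 1:] ^ g_stat (n - 1) T)"
proof -
  have "Suc (n - 1) = n" using assms by simp
  then show ?thesis
    using sum_placements[of "n - 1"] by (simp cong: sum.cong add: statistics_weight)
qed

end
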